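(* Let $X$ be a positive Markov process with pointwise generator $\mathcal{X}$ and assume that $\{\mathsf{e}^y:y\in(0,\infty)\}\subset D_{\mathcal{X}}$. Then there exists a unique Lévy family $l$ such that $$(\mathcal{X}\mathsf{e}^y)(x)=\begin{cases}\psi_l(x,y)e^{-xy},& x\in[0,\infty),\\ \psi_l(x,y),& x=\infty,\end{cases}\qquad y\in(0,\infty).$$
   Context: Positive Markov process: a time-homogeneous Markov process with values in $[0,\infty]$ (Borel $\sigma$-field), under probabilities $(\mathbb{P}_x)_{x\in[0,\infty]}$ on a common measurable space, with $x\mapsto\mathbb{P}_x(X_t\in A)$ Borel, $\mathbb{P}_x(X_0=x)=1$ and the Markov property; no path regularity is assumed. $P_tf(x)=\mathbb{E}_x[f(X_t)]$. The pointwise generator $\mathcal{X}$ has domain $D_{\mathcal{X}}$ consisting of all bounded Borel $f:[0,\infty]\to\mathbb{R}$ for which $\mathcal{X}f(x):=\lim_{t\downarrow0}\frac{P_tf(x)-f(x)}{t}$ exists in $\mathbb{R}$ for every $x\in[0,\infty]$. For $y\in(0,\infty)$, $\mathsf{e}^y:[0,\infty]\to[0,1]$ is $\mathsf{e}^y(u)=e^{-uy}$, with $\mathsf{e}^y(\infty)=0$. For $x\in(0,\infty)$, an $x$-Lévy quadruplet is $l_x=(\nu_x,a_x,b_x,c_x)$ with $\nu_x$ a measure on the Borel sets of $[-x,\infty)$, $\int(1\wedge u^2)\nu_x(\mathrm{d}u)<\infty$, $\nu_x(\{0\})=0$, $a_x\in[0,\infty)$, $b_x\in\mathbb{R}$,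 $c_x\in[0,\infty)$; put $$\psi_{l_x}(y)=\int\big(e^{-uy}-1+uy\mathbf{1}_{[-1,1]}(u)\big)\nu_x(\mathrm{d}u)+a_xy^2-b_xy-c_x,\quad y\in(0,\infty).$$ A Lévy triplet is $l_0=(\nu_0,d_0,c_0)$ with $\nu_0$ a measure on the Borel sets of $(0,\infty)$, $\int(1\wedge u)\nu_0(\mathrm{d}u)<\infty$, $d_0,c_0\in[0,\infty)$; put $\psi_{l_0}(y)=\int(e^{-uy}-1)\nu_0(\mathrm{d}u)-d_0y-c_0$. A Lévy pair is $l_\infty=(\nu_\infty,k_\infty)$ with $\nu_\infty$ a measure on the Borel sets of $(0,\infty)$ with $\int e^{-uy}\nu_\infty(\mathrm{d}u)<\infty$ for all $y\in(0,\infty)$ and $k_\infty\in[0,\infty)$; put $\psi_{l_\infty}(y)=\int e^{-uy}\nu_\infty(\mathrm{d}u)+k_\infty$. A family $l=(l_x)_{x\in[0,\infty]}$ is Lévy if $l_x$ is an $x$-Lévy quadruplet for each $x\in(0,\infty)$, $l_0$ is a Lévy triplet, $l_\infty$ is a Lévy pair, and $(0,\infty)\ni x\mapsto l_x$ is measurable (i.e. $a_x,b_x,c_x$ and $x\mapsto\int g(u)(1\wedge u^2)\nu_x(\mathrm{d}u)$ are Borel in $x\in(0,\infty)$ for every bounded Borel $g:\mathbb{R}\to\mathbb{R}$, with $\nu_x$ regarded as a measure on $\mathbb{R}$). Then $\psi_l(x,y):=\psi_{l_x}(y)$, $(x,y)\in[0,\infty]\times(0,\infty)$. *)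

theory Defs
  imports "HOL-Probability.Probability"
begin

section \<open>Positive Markov processes\<close>

text \<open>The state space $[0,\infty]$ is \<^typ>\<open>ennreal\<close> with its Borel sets, time is the set of
  nonnegative reals (values of \<open>X t\<close> for \<open>t < 0\<close> are irrelevant).\<close>

definition natural_filtration ::
  "'w measure \<Rightarrow> (real \<Rightarrow> 'w \<Rightarrow> ennreal) \<Rightarrow> real \<Rightarrow> 'w measure" where
  "natural_filtration M X s =
     sigma (space M) {X u -` A \<inter> space M | u A. 0 \<le> u \<and> u \<le> s \<and> A \<in> sets borel}"

text \<open>\<open>M\<close> only serves as the common measurable space; its measure plays no role. The Markov property
  is the one with respect to the natural filtration.\<close>

locale positive_markov_process =
  fixes M :: "'w measure"
    and P :: "ennreal \<Rightarrow> 'w measure"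
    and X :: "real \<Rightarrow> 'w \<Rightarrow> ennreal"
  assumes prob_space_P: "\<And>x. prob_space (P x)"
    and sets_P: "\<And>x. sets (P x) = sets M"
    and measurable_X: "\<And>t. 0 \<le> t \<Longrightarrow> X t \<in> measurable M borel"
    and measurable_kernel: "\<And>t A. 0 \<le> t \<Longrightarrow> A \<in> sets borel \<Longrightarrow>
          (\<lambda>x. measure (P x) {\<omega> \<in> space M. X t \<omega> \<in> A}) \<in> borel_measurable borel"
    and start: "\<And>x. measure (P x) {\<omega> \<in> space M. X 0 \<omega> = x} = 1"
    and markov: "\<And>x s t A. 0 \<le> s \<Longrightarrow> 0 \<le> t \<Longrightarrow> A \<in> sets borel \<Longrightarrow>
          AE \<omega> in P x.
            real_cond_exp (P x) (natural_filtration M X s) (\<lambda>\<omega>'. indicator A (X (s + t) \<omega>')) \<omega>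
              = measure (P (X s \<omega>)) {\<omega>' \<in> space M. X t \<omega>' \<in> A}"

definition transition_op ::
  "(ennreal \<Rightarrow> 'w measure) \<Rightarrow> (real \<Rightarrow> 'w \<Rightarrow> ennreal) \<Rightarrow> real \<Rightarrow> (ennreal \<Rightarrow> real) \<Rightarrow> ennreal \<Rightarrow> real" where
  "transition_op P X t f x = (\<integral>\<omega>. f (X t \<omega>) \<partial>P x)"

definition generator_dom ::
  "(ennreal \<Rightarrow> 'w measure) \<Rightarrow> (real \<Rightarrow> 'w \<Rightarrow> ennreal) \<Rightarrow> (ennreal \<Rightarrow> real) set" where
  "generator_dom P X = {f. f \<in> borel_measurable borel \<and> bounded (range f) \<and>
     (\<forall>x. \<exists>L. ((\<lambda>t. (transition_op P X t f x - f x) / t) \<longlongrightarrow> L) (at_right 0))}"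

text \<open>Meaningful for \<open>f\<close> in \<^const>\<open>generator_dom\<close> only.\<close>

definition generator ::
  "(ennreal \<Rightarrow> 'w measure) \<Rightarrow> (real \<Rightarrow> 'w \<Rightarrow> ennreal) \<Rightarrow> (ennreal \<Rightarrow> real) \<Rightarrow> ennreal \<Rightarrow> real" where
  "generator P X f x = Lim (at_right 0) (\<lambda>t. (transition_op P X t f x - f x) / t)"

definition exp_fun :: "real \<Rightarrow> ennreal \<Rightarrow> real" where
  "exp_fun y u = (if u = \<infinity> then 0 else exp (- (enn2real u * y)))"


section \<open>Levy families\<close>

text \<open>One type for the data at all points of $[0,\infty]$, so that a family is a function on
  \<^typ>\<open>ennreal\<close> and uniqueness of a family is plain equality of functions.\<close>

datatype levy_data =
    Levy_Quadruplet (jumps: "real measure") (diffusion: real) (drift: real) (killing: real)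
  | Levy_Triplet (jumps: "real measure") (drift0: real) (killing: real)
  | Levy_Pair (jumps: "real measure") (mass0: real)

fun is_levy_quadruplet :: "real \<Rightarrow> levy_data \<Rightarrow> bool" where
  "is_levy_quadruplet x (Levy_Quadruplet \<nu> a b c) \<longleftrightarrow>
     sets \<nu> = sets (restrict_space borel {- x..}) \<and>
     (\<integral>\<^sup>+u. ennreal (min 1 (u\<^sup>2)) \<partial>\<nu>) < \<infinity> \<and> emeasure \<nu> {0} = 0 \<and> 0 \<le> a \<and> 0 \<le> c"
| "is_levy_quadruplet x _ \<longleftrightarrow> False"

fun is_levy_triplet :: "levy_data \<Rightarrow> bool" where
  "is_levy_triplet (Levy_Triplet \<nu> d c) \<longleftrightarrow>
     sets \<nu> = sets (restrict_space borel {0<..}) \<and>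
     (\<integral>\<^sup>+u. ennreal (min 1 u) \<partial>\<nu>) < \<infinity> \<and> 0 \<le> d \<and> 0 \<le> c"
| "is_levy_triplet _ \<longleftrightarrow> False"

fun is_levy_pair :: "levy_data \<Rightarrow> bool" where
  "is_levy_pair (Levy_Pair \<nu> k) \<longleftrightarrow>
     sets \<nu> = sets (restrict_space borel {0<..}) \<and>
     (\<forall>y>0. (\<integral>\<^sup>+u. ennreal (exp (- (u * y))) \<partial>\<nu>) < \<infinity>) \<and> 0 \<le> k"
| "is_levy_pair _ \<longleftrightarrow> False"

fun levy_symbol :: "levy_data \<Rightarrow> real \<Rightarrow> real" where
  "levy_symbol (Levy_Quadruplet \<nu> a b c) y =
     (\<integral>u. (exp (- (u * y)) - 1 + u * y * indicator {-1..1} u) \<partial>\<nu>) + a * y\<^sup>2 - b * y - c"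
| "levy_symbol (Levy_Triplet \<nu> d c) y = (\<integral>u. (exp (- (u * y)) - 1) \<partial>\<nu>) - d * y - c"
| "levy_symbol (Levy_Pair \<nu> k) y = (\<integral>u. exp (- (u * y)) \<partial>\<nu>) + k"

text \<open>Since \<open>jumps (l x)\<close> lives on $[-x,\infty)$, integrating over it is the same as integrating
  over its extension by zero to the real line.\<close>

definition levy_family :: "(ennreal \<Rightarrow> levy_data) \<Rightarrow> bool" where
  "levy_family l \<longleftrightarrow>
     (\<forall>x>0. is_levy_quadruplet x (l (ennreal x))) \<and>
     is_levy_triplet (l 0) \<and>
     is_levy_pair (l \<infinity>) \<and>
     (\<lambda>x. diffusion (l (ennreal x))) \<in> borel_measurable (restrict_space borel {0<..}) \<and>
     (\<lambda>x. drift (l (ennreal x))) \<in> borel_measurable (restrict_space borel {0<..}) \<and>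
     (\<lambda>x. killing (l (ennreal x))) \<in> borel_measurable (restrict_space borel {0<..}) \<and>
     (\<forall>g :: real \<Rightarrow> real. g \<in> borel_measurable borel \<longrightarrow> bounded (range g) \<longrightarrow>
        (\<lambda>x. \<integral>u. g u * min 1 (u\<^sup>2) \<partial>jumps (l (ennreal x)))
          \<in> borel_measurable (restrict_space borel {0<..}))"

definition family_symbol :: "(ennreal \<Rightarrow> levy_data) \<Rightarrow> ennreal \<Rightarrow> real \<Rightarrow> real" where
  "family_symbol l x y = levy_symbol (l x) y"

end

theory Submission
  imports Defs
begin

text \<open>
  In the coordinate \<open>v = exp (- u)\<close> the state space is \<open>{0..1}\<close>, with \<open>v = 0\<close> for infinity, and the functions
  \<open>exp_fun y\<close> are the powers \<open>v powr y\<close>. Fix a starting point \<open>x\<close>, put \<open>p = exp (- x)\<close>, and let \<open>\<mu>\<^sub>t\<close> be the law of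
  \<open>exp (- X t)\<close> on \<open>{0..1}\<close>. By hypothesis \<open>(\<integral>v. v powr y \<partial>\<mu>\<^sub>t - p powr y) / t\<close> converges to a number \<open>G y\<close> for
  every \<open>y > 0\<close>. If \<open>q\<close> is a polynomial that is nonnegative on \<open>{0..1}\<close> and zero at \<open>p\<close>, then the moments
  of the measures \<open>q(v) \<mu>\<^sub>t(dv) / t\<close> are linear combinations of such quotients. They converge, and on a
  compact interval this gives a weak limit \<open>\<rho>\<close> (theorem \<open>moment_limit_measure\<close>).

  For \<open>0 < x < \<infinity>\<close> take \<open>q(v) = (v - p)\<^sup>2\<close>. Taylor expansion of \<open>v powr y\<close> at \<open>p\<close> gives \<open>G y\<close> as
  \<open>y * p powr (y - 1) * G 1\<close> plus the integral of a continuous function with respect to \<open>\<rho>\<close> (lemma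
  \<open>second_order_limit\<close>). The part of \<open>\<rho>\<close> outside \<open>0\<close> and \<open>p\<close>, divided by \<open>q\<close>, is the jump measure, and
  up to constant factors the atom at \<open>p\<close> is the diffusion coefficient and the atom at \<open>0\<close> the killing
  rate (lemma \<open>quadruplet_of_correct\<close>). For \<open>x = 0\<close>, where \<open>p = 1\<close> is an end point, \<open>q(v) = 1 - v\<close> suffices and leads to a
  Levy triplet (lemma \<open>triplet_limit\<close>). For \<open>x = \<infinity>\<close>, where \<open>p = 0\<close>, the weights \<open>v powr z\<close> with \<open>z > 0\<close>
  lead to a Levy pair (lemma \<open>pair_limit\<close>).

  The integral of a continuous function with respect to \<open>\<rho>\<close> is a limit of measurable functions of \<open>x\<close>. Hence
  \<open>\<rho>\<close> is a measurable kernel, and the components of the quadruplets, being integrals of jointly measurable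
  functions with respect to it, are measurable (lemma \<open>levy_data_measurable\<close>).

  For uniqueness, fourth differences in \<open>y\<close> remove drift, diffusion, killing and compensator from a
  symbol. What remains are the integrals of \<open>exp (- (u * y)) * (1 - exp (- u)) ^ 4\<close> with respect to the jump
  measure, which for \<open>y = 1, 2, \<dots>\<close> are the moments of a finite measure on a bounded interval. They determine the
  jump measure (lemma \<open>jump_measure_unique\<close>), and then the other parameters are the coefficients of a
  polynomial.
\<close>

section \<open>Moments of measures on a bounded interval\<close>

text \<open>A finite Borel measure on the real line that is carried by the interval from \<open>0\<close> to \<open>R\<close>. Keeping
  the Borel sets of the whole line as sigma-algebra avoids restricted measure spaces in all limits.\<close>

definition finite_on :: "real \<Rightarrow> real measure \<Rightarrow> bool" where
  "finite_on R \<rho> \<longleftrightarrow> finite_measure \<rho> \<and> sets \<rho> = sets borel \<and> (AE v in \<rho>. v \<in> {0..R})"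

lemma finite_onD:
  assumes "finite_on R \<rho>"
  shows "finite_measure \<rho>" "sets \<rho> = sets borel" "AE v in \<rho>. v \<in> {0..R}" "space \<rho> = UNIV"
  using assms sets_eq_imp_space_eq[of \<rho> borel] by (auto simp: finite_on_def)

lemma AE_pos_weight:
  assumes "finite_on 1 \<rho>" "\<And>v. 0 \<le> v \<Longrightarrow> v \<le> 1 \<Longrightarrow> 0 \<le> q v"
  shows "AE v in \<rho>. 0 \<le> (q v :: real)"
  using finite_onD(3)[OF assms(1)] by eventually_elim (use assms(2) in auto)

lemma finite_on_integrable:
  assumes \<rho>: "finite_on R \<rho>" and f: "f \<in> borel_measurable borel" "continuous_on {0..R} f"
  shows "integrable \<rho> (f :: real \<Rightarrow> real)"
proof -
  interpret finite_measure \<rho> using finite_onD[OF \<rho>] by simp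
  have "compact (f ` {0..R})"
    using f(2) by (intro compact_continuous_image) auto
  then obtain B where B: "\<And>v. v \<in> {0..R} \<Longrightarrow> norm (f v) \<le> B"
    using bounded_iff compact_imp_bounded by (metis imageI)
  show ?thesis
  proof (rule integrable_const_bound)
    show "AE v in \<rho>. norm (f v) \<le> B"
      using finite_onD(3)[OF \<rho>] B by auto
    show "f \<in> borel_measurable \<rho>"
      using f finite_onD(2)[OF \<rho>] by (simp cong: measurable_cong_sets)
  qed
qed

text \<open>Weierstrass approximation passes convergence from monomials to all continuous functions.\<close>

lemma integral_tendsto_if_moments_tendsto:
  assumes \<sigma>: "\<And>n. finite_on R (\<sigma> n)" and \<rho>: "finite_on R \<rho>"
    and mom: "\<And>k. (\<lambda>n. \<integral>v. v ^ k \<partial>\<sigma> n) \<longlonglongrightarrow> (\<integral>v. v ^ k \<partial>\<rho>)"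
    and f: "f \<in> borel_measurable borel" "continuous_on {0..R} f"
  shows "(\<lambda>n. \<integral>v. f v \<partial>\<sigma> n) \<longlonglongrightarrow> (\<integral>v. f v \<partial>\<rho> :: real)"
proof (rule LIMSEQ_I)
  fix e :: real assume "0 < e"
  define K where "K = measure \<rho> UNIV + 1"
  have K: "K > 0" by (simp add: K_def add_nonneg_pos)
  define d where "d = e / (4 * K)"
  have d: "d > 0" using \<open>0 < e\<close> K by (simp add: d_def)
  obtain p where p: "real_polynomial_function p" "\<And>v. v \<in> {0..R} \<Longrightarrow> \<bar>f v - p v\<bar> < d"
    using Stone_Weierstrass_real_polynomial_function[OF _ f(2) d] by auto
  obtain a N where pa: "p = (\<lambda>v. \<Sum>i\<le>N. a i * v ^ i)"
    using p(1) real_polynomial_function_iff_sum by auto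
  have pm: "p \<in> borel_measurable borel" "continuous_on {0..R} p"
    unfolding pa by (auto intro!: continuous_intros)
  have int_pow: "integrable \<tau> (\<lambda>v. v ^ i)" if "finite_on R \<tau>" for \<tau> i
    by (rule finite_on_integrable[OF that]) (auto intro!: continuous_intros)
  have ip: "(\<integral>v. p v \<partial>\<tau>) = (\<Sum>i\<le>N. a i * (\<integral>v. v ^ i \<partial>\<tau>))" if "finite_on R \<tau>" for \<tau>
    unfolding pa using int_pow[OF that] by (subst Bochner_Integration.integral_sum) auto
  have approx: "\<bar>(\<integral>v. f v \<partial>\<tau>) - (\<integral>v. p v \<partial>\<tau>)\<bar> \<le> d * measure \<tau> UNIV" if \<tau>: "finite_on R \<tau>" for \<tau>
  proof -
    interpret finite_measure \<tau> using finite_onD[OF \<tau>] by simp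
    note I = finite_on_integrable[OF \<tau>]
    have "\<bar>(\<integral>v. f v \<partial>\<tau>) - (\<integral>v. p v \<partial>\<tau>)\<bar> = \<bar>\<integral>v. f v - p v \<partial>\<tau>\<bar>"
      by (simp add: I[OF f] I[OF pm])
    also have "\<dots> \<le> (\<integral>v. \<bar>f v - p v\<bar> \<partial>\<tau>)"
      by (rule integral_abs_bound)
    also have "\<dots> \<le> (\<integral>v. d \<partial>\<tau>)"
    proof (rule integral_mono_AE)
      show "AE v in \<tau>. \<bar>f v - p v\<bar> \<le> d"
        using finite_onD(3)[OF \<tau>] p(2) by (auto intro: less_imp_le)
    qed (auto intro!: integrable_abs Bochner_Integration.integrable_diff I[OF f] I[OF pm])
    finally show ?thesis by (simp add: finite_onD[OF \<tau>] mult.commute)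
  qed
  have "(\<lambda>n. measure (\<sigma> n) UNIV) \<longlonglongrightarrow> measure \<rho> UNIV"
    using mom[of 0] by (simp add: finite_onD[OF \<rho>] finite_onD[OF \<sigma>])
  then have "\<forall>\<^sub>F n in sequentially. measure (\<sigma> n) UNIV < K"
    by (rule order_tendstoD) (simp add: K_def)
  moreover have "(\<lambda>n. \<integral>v. p v \<partial>\<sigma> n) \<longlonglongrightarrow> (\<integral>v. p v \<partial>\<rho>)"
    unfolding ip[OF \<rho>] ip[OF \<sigma>] by (intro tendsto_intros mom)
  then have "\<forall>\<^sub>F n in sequentially. dist (\<integral>v. p v \<partial>\<sigma> n) (\<integral>v. p v \<partial>\<rho>) < e / 4"
    by (rule tendstoD) (use \<open>0 < e\<close> in auto)
  ultimately have "\<forall>\<^sub>F n in sequentially. norm ((\<integral>v. f v \<partial>\<sigma> n) - (\<integral>v. f v \<partial>\<rho>)) < e"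
  proof eventually_elim
    case (elim n)
    have "d * measure (\<sigma> n) UNIV \<le> d * K" "d * measure \<rho> UNIV \<le> d * K"
      using elim d by (auto simp: K_def intro!: mult_left_mono)
    moreover have "d * K = e / 4" using K by (simp add: d_def field_simps)
    ultimately show ?case
      using approx[OF \<sigma>[of n]] approx[OF \<rho>] elim(2) \<open>0 < e\<close> unfolding dist_real_def real_norm_def by linarith
  qed
  then show "\<exists>N. \<forall>n\<ge>N. norm ((\<integral>v. f v \<partial>\<sigma> n) - (\<integral>v. f v \<partial>\<rho>)) < e"
    by (simp add: eventually_sequentially)
qed

lemma cts_step_bounds:
  assumes "a < b"
  shows "0 \<le> cts_step a b v" "cts_step a b v \<le> 1"
  using assms by (auto simp: cts_step_def divide_simps)

lemma cts_step_tendsto_cdf: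
  assumes \<rho>: "finite_measure \<rho>" "sets \<rho> = sets borel"
  shows "(\<lambda>k. \<integral>v. cts_step a (a + inverse (real (Suc k))) v \<partial>\<rho>) \<longlonglongrightarrow> measure \<rho> {..a}"
proof -
  interpret finite_measure \<rho> by fact
  note [measurable_cong] = \<rho>(2)
  have cm: "cts_step b c \<in> borel_measurable borel" if "b < c" for b c
    using uniformly_continuous_imp_continuous[OF cts_step_uniformly_continuous[OF that]]
    by (rule borel_measurable_continuous_onI)
  have "(\<lambda>k. \<integral>v. cts_step a (a + inverse (real (Suc k))) v \<partial>\<rho>) \<longlonglongrightarrow> (\<integral>v. indicator {..a} v \<partial>\<rho>)"
  proof (rule integral_dominated_convergence[where w="\<lambda>_. 1"])
    fix k
    show "cts_step a (a + inverse (real (Suc k))) \<in> borel_measurable \<rho>"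
      using cm[of a "a + inverse (real (Suc k))"] by (simp cong: measurable_cong_sets add: \<rho>)
    show "AE v in \<rho>. norm (cts_step a (a + inverse (real (Suc k))) v) \<le> 1"
      using cts_step_bounds[of a "a + inverse (real (Suc k))"] by (intro AE_I2) auto
  next
    show "AE v in \<rho>. (\<lambda>k. cts_step a (a + inverse (real (Suc k))) v) \<longlonglongrightarrow> indicat_real {..a} v"
    proof (rule AE_I2)
      fix v
      show "(\<lambda>k. cts_step a (a + inverse (real (Suc k))) v) \<longlonglongrightarrow> indicat_real {..a} v"
      proof (cases "v \<le> a")
        case True then show ?thesis by (simp add: cts_step_def)
      next
        case False
        have "\<forall>\<^sub>F k in sequentially. inverse (real (Suc k)) < v - a"
          using False by (intro order_tendstoD[OF LIMSEQ_inverse_real_of_nat]) auto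
        then have "\<forall>\<^sub>F k in sequentially. cts_step a (a + inverse (real (Suc k))) v = indicat_real {..a} v"
          by eventually_elim (use False in \<open>auto simp: cts_step_def\<close>)
        then show ?thesis by (rule tendsto_eventually)
      qed
    qed
  qed (auto simp: \<rho>)
  then show ?thesis by simp
qed

lemma measure_eq_if_moments_eq:
  assumes \<rho>: "finite_on R \<rho>" and \<tau>: "finite_on R \<tau>"
    and mom: "\<And>k. (\<integral>v. v ^ k \<partial>\<rho>) = (\<integral>v. v ^ k \<partial>\<tau>)"
  shows "\<rho> = \<tau>"
proof -
  interpret \<rho>: finite_measure \<rho> using finite_onD[OF \<rho>] by simp
  interpret \<tau>: finite_measure \<tau> using finite_onD[OF \<tau>] by simp
  have cont: "continuous_on UNIV (cts_step b c)" if "b < c" for b c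
    using uniformly_continuous_imp_continuous[OF cts_step_uniformly_continuous[OF that]] .
  have eq: "(\<integral>v. cts_step b c v \<partial>\<rho>) = (\<integral>v. cts_step b c v \<partial>\<tau>)" if "b < c" for b c
  proof -
    have "(\<lambda>n::nat. \<integral>v. cts_step b c v \<partial>\<rho>) \<longlonglongrightarrow> (\<integral>v. cts_step b c v \<partial>\<tau>)"
      by (rule integral_tendsto_if_moments_tendsto[where R=R])
        (use \<rho> \<tau> mom cont[OF that] in
          \<open>auto intro: borel_measurable_continuous_onI continuous_on_subset\<close>)
    then show ?thesis by (simp add: LIMSEQ_const_iff)
  qed
  have "measure \<rho> {..a} = measure \<tau> {..a}" for a
  proof (rule LIMSEQ_unique)
    show "(\<lambda>k. \<integral>v. cts_step a (a + inverse (real (Suc k))) v \<partial>\<rho>) \<longlonglongrightarrow> measure \<rho> {..a}"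
      using finite_onD[OF \<rho>] by (intro cts_step_tendsto_cdf)
    show "(\<lambda>k. \<integral>v. cts_step a (a + inverse (real (Suc k))) v \<partial>\<rho>) \<longlonglongrightarrow> measure \<tau> {..a}"
      using cts_step_tendsto_cdf[of \<tau> a] finite_onD[OF \<tau>] by (subst eq) auto
  qed
  then have "cdf \<rho> = cdf \<tau>" by (auto simp: cdf_def)
  moreover have "finite_borel_measure \<rho>" "finite_borel_measure \<tau>"
    using finite_onD[OF \<rho>] finite_onD[OF \<tau>]
    by (auto simp: finite_borel_measure_def finite_borel_measure_axioms_def)
  ultimately show ?thesis using cdf_unique' by blast
qed

text \<open>The compactness input: no limit measure is given, it is obtained from Helly's selection theorem,
  applied to the normalised measures. If the total masses tend to zero, normalisation is not possible,
  but then all moments tend to zero and the zero measure is the limit.\<close>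

theorem moment_limit_measure:
  assumes \<sigma>: "\<And>n. finite_on 1 (\<sigma> n)"
    and mom: "\<And>k. (\<lambda>n. \<integral>v. v ^ k \<partial>\<sigma> n) \<longlonglongrightarrow> m k"
  obtains \<rho> where "finite_on 1 \<rho>"
    "\<And>f :: real \<Rightarrow> real. f \<in> borel_measurable borel \<Longrightarrow> continuous_on {0..1} f \<Longrightarrow>
      (\<lambda>n. \<integral>v. f v \<partial>\<sigma> n) \<longlonglongrightarrow> (\<integral>v. f v \<partial>\<rho>)"
proof -
  have "\<exists>\<rho>. finite_on 1 \<rho> \<and> (\<forall>k. (\<integral>v. v ^ k \<partial>\<rho>) = m k)"
  proof -
    define mass where "mass n = measure (\<sigma> n) UNIV" for n
    have mass: "mass \<longlonglongrightarrow> m 0"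
      using mom[of 0] by (simp add: mass_def[abs_def] finite_onD[OF \<sigma>])
    have mass0: "mass n \<ge> 0" for n by (simp add: mass_def)
    have m0: "m 0 \<ge> 0" using LIMSEQ_le_const[OF mass] mass0 by blast
    have ipow: "integrable (\<sigma> n) (\<lambda>v. v ^ k)" for n k
      by (rule finite_on_integrable[OF \<sigma>]) (auto intro!: continuous_intros)
    have pow_bound: "\<bar>\<integral>v. v ^ k \<partial>\<sigma> n\<bar> \<le> mass n" for n k
    proof -
      interpret finite_measure "\<sigma> n" using finite_onD[OF \<sigma>] by simp
      have "\<bar>\<integral>v. v ^ k \<partial>\<sigma> n\<bar> \<le> (\<integral>v. \<bar>v ^ k\<bar> \<partial>\<sigma> n)" by (rule integral_abs_bound)
      also have "\<dots> \<le> (\<integral>v. 1 \<partial>\<sigma> n)"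
        using finite_onD(3)[OF \<sigma>[of n]]
        by (intro integral_mono_AE) (auto intro!: ipow simp: power_le_one)
      finally show ?thesis by (simp add: mass_def finite_onD[OF \<sigma>])
    qed
    show ?thesis
    proof (cases "m 0 = 0")
      case True
      have "m k = 0" for k
      proof -
        have "(\<lambda>n. \<integral>v. v ^ k \<partial>\<sigma> n) \<longlonglongrightarrow> 0"
          by (rule Lim_null_comparison[OF _ mass[unfolded True]]) (use pow_bound in auto)
        with mom[of k] show ?thesis by (rule LIMSEQ_unique)
      qed
      moreover have "finite_on 1 (null_measure borel)"
        by (auto simp: finite_on_def AE_iff_null intro!: finite_measureI)
      ultimately show ?thesis
        by (intro exI[of _ "null_measure borel"]) (auto simp: integral_null_measure)
    next
      case False
      then have m0: "m 0 > 0" using m0 by simp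
      \<comment> \<open>The default \<open>return borel 0\<close> is taken for finitely many \<open>n\<close> only.\<close>
      define \<tau> where "\<tau> n = (if mass n > 0 then density (\<sigma> n) (\<lambda>_. ennreal (1 / mass n))
        else return borel 0)" for n
      have sets_\<tau>[simp]: "sets (\<tau> n) = sets borel" for n
        by (simp add: \<tau>_def finite_onD[OF \<sigma>])
      note [measurable_cong] = sets_\<tau>
      have space_\<tau>[simp]: "space (\<tau> n) = UNIV" for n
        using sets_eq_imp_space_eq[OF sets_\<tau>] by simp
      have prob_\<tau>: "prob_space (\<tau> n)" for n
      proof (cases "mass n > 0")
        case True
        interpret finite_measure "\<sigma> n" using finite_onD[OF \<sigma>] by simp
        have "emeasure (density (\<sigma> n) (\<lambda>_. ennreal (1 / mass n))) UNIV = ennreal (1 / mass n) * emeasure (\<sigma> n) UNIV"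
          by (subst emeasure_density) (auto simp: finite_onD[OF \<sigma>] nn_integral_cmult)
        also have "\<dots> = 1"
          using True by (simp add: emeasure_eq_measure flip: ennreal_mult' mass_def)
        finally show ?thesis
          using True by (intro prob_spaceI) (auto simp: \<tau>_def finite_onD[OF \<sigma>])
      qed (auto simp: \<tau>_def intro!: prob_space_return)
      have AE_\<tau>: "AE v in \<tau> n. v \<in> {0..1}" for n
      proof (cases "mass n > 0")
        case True
        have "AE v in density (\<sigma> n) (\<lambda>_. ennreal (1 / mass n)). v \<in> {0..1}"
          using finite_onD(3)[OF \<sigma>[of n]] by (subst AE_density) auto
        then show ?thesis unfolding \<tau>_def using True by (simp only: if_True)
      next
        case False
        have "AE v in return borel (0::real). v \<in> {0..1}"
          by (subst AE_return) auto
        then show ?thesis unfolding \<tau>_def using False by (simp only: if_False)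
      qed
      have "tight \<tau>"
        unfolding tight_def
      proof safe
        fix n show "real_distribution (\<tau> n)"
          using prob_\<tau> by (auto simp: real_distribution_def real_distribution_axioms_def)
      next
        fix e :: real assume "0 < e"
        have "measure (\<tau> n) {-1<..1} = 1" for n
        proof -
          interpret prob_space "\<tau> n" by (rule prob_\<tau>)
          show ?thesis using AE_\<tau>[of n] by (subst prob_eq_1) auto
        qed
        then show "\<exists>a b. a < b \<and> (\<forall>n. 1 - e < measure (\<tau> n) {a<..b})"
          using \<open>0 < e\<close> by (intro exI[of _ "-1"] exI[of _ 1]) auto
      qed
      then obtain r T where r: "strict_mono (r :: nat \<Rightarrow> nat)" and T: "real_distribution T"
        and w: "weak_conv_m (\<tau> \<circ> r) T"
        using tight_imp_convergent_subsubsequence[of \<tau> id] by (auto simp: strict_mono_def)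
      interpret T: real_distribution T by fact
      have rd: "real_distribution ((\<tau> \<circ> r) n)" for n
        using prob_\<tau> by (auto simp: real_distribution_def real_distribution_axioms_def)
      have conv: "(\<lambda>n. \<integral>v. f v \<partial>\<tau> (r n)) \<longlonglongrightarrow> (\<integral>v. f v \<partial>T)"
        if "\<And>v. isCont f v" "\<And>v. norm (f v) \<le> B" for f :: "real \<Rightarrow> real" and B
        using weak_conv_imp_integral_bdd_continuous_conv[OF rd T w that] by simp
      have AE_T: "AE v in T. v \<in> {0..1}"
      proof -
        \<comment> \<open>a bounded continuous function that vanishes exactly on \<open>{0..1}\<close>\<close>
        define g :: "real \<Rightarrow> real" where "g v = max 0 (min 1 (max (- v) (v - 1)))" for v
        have "isCont g v" for v
          unfolding g_def by (intro continuous_intros)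
        moreover have "norm (g v) \<le> 1" "g v \<ge> 0" "g v = 0 \<longleftrightarrow> v \<in> {0..1}" for v
          unfolding g_def by (auto simp: max_def min_def)
        ultimately have g: "isCont g v" "norm (g v) \<le> 1" "g v \<ge> 0" "g v = 0 \<longleftrightarrow> v \<in> {0..1}" for v
          by auto
        have gm: "g \<in> borel_measurable borel"
          unfolding g_def by measurable
        have "(\<integral>v. g v \<partial>\<tau> n) = 0" for n
          using AE_\<tau>[of n] g(4) by (intro integral_eq_zero_AE) auto
        then have "(\<integral>v. g v \<partial>T) = 0"
          using conv[of g 1] g by (simp add: LIMSEQ_const_iff)
        moreover have "integrable T g"
          using g gm by (intro T.integrable_const_bound[of _ 1]) auto
        ultimately have "AE v in T. g v = 0"
          using g by (subst (asm) integral_nonneg_eq_0_iff_AE) auto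
        then show ?thesis using g(4) by simp
      qed
      define \<rho> where "\<rho> = density T (\<lambda>_. ennreal (m 0))"
      have "(\<integral>v. v ^ k \<partial>\<rho>) = m k" for k
      proof -
        \<comment> \<open>Clamping makes the monomial bounded and does not change it on \<open>{0..1}\<close>.\<close>
        define f :: "real \<Rightarrow> real" where "f v = (max 0 (min 1 v)) ^ k" for v
        have "isCont f v" for v
          unfolding f_def by (intro continuous_intros)
        moreover have "norm (f v) \<le> 1" for v
          unfolding f_def by (auto simp: power_le_one)
        ultimately have f: "isCont f v" "norm (f v) \<le> 1" for v
          by auto
        have fpow: "f v = v ^ k" if "v \<in> {0..1}" for v
          using that by (simp add: f_def)
        have [measurable]: "f \<in> borel_measurable borel" unfolding f_def by measurable
        have "(\<lambda>n. (\<integral>v. v ^ k \<partial>\<sigma> n) / mass n) \<longlonglongrightarrow> m k / m 0"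
          using m0 by (intro tendsto_divide mom mass) auto
        then have "(\<lambda>n. (\<integral>v. v ^ k \<partial>\<sigma> (r n)) / mass (r n)) \<longlonglongrightarrow> m k / m 0"
          using LIMSEQ_subseq_LIMSEQ[OF _ r] by (auto simp: comp_def)
        moreover have "\<forall>\<^sub>F n in sequentially. mass n > 0"
          using order_tendstoD(1)[OF mass m0] .
        then have "\<forall>\<^sub>F n in sequentially. mass (r n) > 0"
          using eventually_subseq[OF r] by blast
        then have "\<forall>\<^sub>F n in sequentially. (\<integral>v. v ^ k \<partial>\<sigma> (r n)) / mass (r n) = (\<integral>v. f v \<partial>\<tau> (r n))"
        proof eventually_elim
          case (elim n)
          have "(\<integral>v. f v \<partial>\<tau> (r n)) = (\<integral>v. v ^ k \<partial>\<tau> (r n))"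
            using AE_\<tau>[of "r n"] fpow by (intro integral_cong_AE) auto
          also have "\<dots> = (\<integral>v. v ^ k \<partial>\<sigma> (r n)) / mass (r n)"
            using elim by (simp add: \<tau>_def integral_density finite_onD[OF \<sigma>]
                measurable_cong_sets[OF finite_onD(2)[OF \<sigma>] refl])
          finally show ?case by simp
        qed
        ultimately have "(\<lambda>n. (\<integral>v. f v \<partial>\<tau> (r n))) \<longlonglongrightarrow> m k / m 0"
          by (rule Lim_transform_eventually)
        then have "m k / m 0 = (\<integral>v. f v \<partial>T)"
          using conv[of f 1] f LIMSEQ_unique by auto
        also have "\<dots> = (\<integral>v. v ^ k \<partial>T)"
          using AE_T fpow by (intro integral_cong_AE) auto
        finally show ?thesis
          using m0 by (simp add: \<rho>_def integral_density field_simps)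
      qed
      moreover have "finite_on 1 \<rho>"
        using AE_T m0 unfolding finite_on_def \<rho>_def
        by (auto intro!: finite_measureI simp: emeasure_density AE_density nn_integral_cmult
            ennreal_mult_eq_top_iff T.emeasure_eq_measure)
      ultimately show ?thesis by blast
    qed
  qed
  then obtain \<rho> where "finite_on 1 \<rho>" "\<And>k. (\<integral>v. v ^ k \<partial>\<rho>) = m k" by auto
  then show ?thesis
    using that[of \<rho>] integral_tendsto_if_moments_tendsto[OF \<sigma>, of \<rho>] mom by auto
qed

lemma finite_on_weight:
  assumes \<rho>: "finite_on 1 \<rho>" and q: "q \<in> borel_measurable borel" "continuous_on {0..1} q"
    "\<And>v. 0 \<le> v \<Longrightarrow> v \<le> 1 \<Longrightarrow> 0 \<le> q v"
  shows "finite_on 1 (density \<rho> (\<lambda>v. ennreal (q v)))"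
    and "f \<in> borel_measurable borel \<Longrightarrow> (\<integral>v. f v \<partial>density \<rho> (\<lambda>v. ennreal (q v))) = (\<integral>v. q v * f v \<partial>\<rho> :: real)"
    and "f \<in> borel_measurable borel \<Longrightarrow>
      integrable (density \<rho> (\<lambda>v. ennreal (q v))) f \<longleftrightarrow> integrable \<rho> (\<lambda>v. q v * f v :: real)"
proof -
  note [measurable_cong] = finite_onD(2)[OF \<rho>] and [measurable] = q(1)
  have pos: "AE v in \<rho>. 0 \<le> q v" using \<rho> q(3) by (rule AE_pos_weight)
  have "emeasure (density \<rho> (\<lambda>v. ennreal (q v))) UNIV = (\<integral>\<^sup>+v. ennreal (q v) \<partial>\<rho>)"
    by (subst emeasure_density) auto
  also have "\<dots> < \<infinity>"
    using pos finite_on_integrable[OF \<rho> q(1,2)] by (subst nn_integral_eq_integral) auto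
  finally have "finite_measure (density \<rho> (\<lambda>v. ennreal (q v)))"
    by (intro finite_measureI) (simp add: finite_onD[OF \<rho>])
  moreover have "AE v in density \<rho> (\<lambda>v. ennreal (q v)). v \<in> {0..1}"
    using finite_onD(3)[OF \<rho>] by (subst AE_density) auto
  moreover have "sets (density \<rho> (\<lambda>v. ennreal (q v))) = sets borel" by (simp add: finite_onD[OF \<rho>])
  ultimately show "finite_on 1 (density \<rho> (\<lambda>v. ennreal (q v)))" by (simp add: finite_on_def)
  show "f \<in> borel_measurable borel \<Longrightarrow> (\<integral>v. f v \<partial>density \<rho> (\<lambda>v. ennreal (q v))) = (\<integral>v. q v * f v \<partial>\<rho>)"
    using pos by (subst integral_density) auto
  show "f \<in> borel_measurable borel \<Longrightarrow>
      integrable (density \<rho> (\<lambda>v. ennreal (q v))) f \<longleftrightarrow> integrable \<rho> (\<lambda>v. q v * f v)"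
    using pos by (subst integrable_density) auto
qed

text \<open>The masses of the measures \<open>s n *\<^sub>R \<mu> n\<close> may explode. The weight \<open>q\<close> is chosen so that it vanishes
  where they do, and the weighted measures converge.\<close>

lemma weighted_limit_measure:
  fixes q :: "real \<Rightarrow> real"
  assumes \<mu>: "\<And>n. finite_on 1 (\<mu> n)" and s: "\<And>n. 0 \<le> s n"
    and q: "q \<in> borel_measurable borel" "continuous_on {0..1} q" "\<And>v. 0 \<le> v \<Longrightarrow> v \<le> 1 \<Longrightarrow> 0 \<le> q v"
    and mom: "\<And>k. (\<lambda>n. s n * (\<integral>v. q v * v ^ k \<partial>\<mu> n)) \<longlonglongrightarrow> m k"
  obtains \<rho> where "finite_on 1 \<rho>"
    "\<And>f :: real \<Rightarrow> real. f \<in> borel_measurable borel \<Longrightarrow> continuous_on {0..1} f \<Longrightarrow>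
      (\<lambda>n. s n * (\<integral>v. q v * f v \<partial>\<mu> n)) \<longlonglongrightarrow> (\<integral>v. f v \<partial>\<rho>)"
proof -
  define \<sigma> where "\<sigma> n = density (\<mu> n) (\<lambda>v. ennreal (s n * q v))" for n
  note [measurable] = q(1)
  have m: "f \<in> borel_measurable (\<mu> n)" if "f \<in> borel_measurable borel" for f :: "real \<Rightarrow> real" and n
    unfolding measurable_cong_sets[OF finite_onD(2)[OF \<mu>] refl] by (rule that)
  have pos: "AE v in \<mu> n. 0 \<le> s n * q v" for n
    using finite_onD(3)[OF \<mu>[of n]] by eventually_elim (use s q(3) in auto)
  have \<sigma>: "finite_on 1 (\<sigma> n)" for n
  proof -
    have I: "integrable (\<mu> n) (\<lambda>v. s n * q v)"
      by (intro integrable_mult_right finite_on_integrable[OF \<mu>] q)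
    have "emeasure (\<sigma> n) UNIV = (\<integral>\<^sup>+v. ennreal (s n * q v) \<partial>\<mu> n)"
      using sets.top[of "\<mu> n"] finite_onD[OF \<mu>[of n]] unfolding \<sigma>_def
      by (subst emeasure_density) (auto intro!: measurable_compose[OF m measurable_ennreal])
    also have "\<dots> < \<infinity>" using I pos by (subst nn_integral_eq_integral) auto
    finally have "finite_measure (\<sigma> n)"
      by (intro finite_measureI) (simp add: \<sigma>_def finite_onD[OF \<mu>])
    moreover have "AE v in \<sigma> n. v \<in> {0..1}"
      unfolding \<sigma>_def using finite_onD(3)[OF \<mu>[of n]]
      by (subst AE_density) (auto intro!: measurable_compose[OF m measurable_ennreal])
    moreover have "sets (\<sigma> n) = sets borel" by (simp add: \<sigma>_def finite_onD[OF \<mu>])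
    ultimately show ?thesis by (simp add: finite_on_def)
  qed
  have int: "(\<integral>v. f v \<partial>\<sigma> n) = s n * (\<integral>v. q v * f v \<partial>\<mu> n)"
    if "f \<in> borel_measurable borel" for f :: "real \<Rightarrow> real" and n
  proof -
    have "(\<integral>v. f v \<partial>\<sigma> n) = (\<integral>v. (s n * q v) *\<^sub>R f v \<partial>\<mu> n)"
      unfolding \<sigma>_def using pos that by (intro integral_density) (auto intro!: m)
    then show ?thesis by (simp add: mult.assoc)
  qed
  have mom': "(\<lambda>n. \<integral>v. v ^ k \<partial>\<sigma> n) \<longlonglongrightarrow> m k" for k
    using mom[of k] by (simp add: int)
  obtain \<rho> where \<rho>: "finite_on 1 \<rho>"
    "\<And>f :: real \<Rightarrow> real. f \<in> borel_measurable borel \<Longrightarrow> continuous_on {0..1} f \<Longrightarrow>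
      (\<lambda>n. \<integral>v. f v \<partial>\<sigma> n) \<longlonglongrightarrow> (\<integral>v. f v \<partial>\<rho>)"
    using moment_limit_measure[OF \<sigma> mom'] by blast
  show ?thesis
    by (rule that[OF \<rho>(1)]) (use \<rho>(2) int in auto)
qed

lemma integral_combination:
  assumes "integrable M f" "integrable M g" "integrable M h"
  shows "(\<integral>v. f v - a * g v + b * h v \<partial>M) = (\<integral>v. f v \<partial>M) - a * (\<integral>v. g v \<partial>M) + b * (\<integral>v. h v \<partial>M :: real)"
  using assms by simp

lemma continuous_on_powr_unit: "0 < y \<Longrightarrow> continuous_on {0..1} (\<lambda>v::real. v powr y)"
  by (intro continuous_on_powr' continuous_intros) auto

section \<open>Measurability of integrals with respect to a family of measures\<close>

text \<open>Measurability in the parameter needs to be checked for continuous integrands only, and then holds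
  for all integrands that are jointly measurable in parameter and integration variable.\<close>

lemma borel_measurable_integral_finite_kernel:
  fixes \<rho> :: "'a \<Rightarrow> real measure" and F :: "'a \<Rightarrow> real \<Rightarrow> real"
  assumes fin: "\<And>x. x \<in> space N \<Longrightarrow> finite_measure (\<rho> x)"
    and sets: "\<And>x. x \<in> space N \<Longrightarrow> sets (\<rho> x) = sets borel"
    and cont: "\<And>f :: real \<Rightarrow> real. continuous_on UNIV f \<Longrightarrow>
      (\<lambda>x. \<integral>v. f v \<partial>\<rho> x) \<in> borel_measurable N"
    and F: "(\<lambda>(x, v). F x v) \<in> borel_measurable (N \<Otimes>\<^sub>M borel)"
  shows "(\<lambda>x. \<integral>v. F x v \<partial>\<rho> x) \<in> borel_measurable N"
proof -
  have space: "space (\<rho> x) = UNIV" if "x \<in> space N" for x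
    using sets_eq_imp_space_eq[OF sets[OF that]] by simp
  have cdf: "(\<lambda>x. measure (\<rho> x) {..a}) \<in> borel_measurable N" for a
  proof (rule borel_measurable_LIMSEQ_real)
    fix x assume "x \<in> space N"
    then show "(\<lambda>k. \<integral>v. cts_step a (a + inverse (real (Suc k))) v \<partial>\<rho> x) \<longlonglongrightarrow> measure (\<rho> x) {..a}"
      by (intro cts_step_tendsto_cdf fin sets)
  next
    fix k
    show "(\<lambda>x. \<integral>v. cts_step a (a + inverse (real (Suc k))) v \<partial>\<rho> x) \<in> borel_measurable N"
      by (intro cont uniformly_continuous_imp_continuous cts_step_uniformly_continuous) auto
  qed
  define m where "m x = measure (\<rho> x) UNIV" for x
  have m_meas [measurable]: "m \<in> borel_measurable N"
  proof -
    have "(\<lambda>x. \<integral>v. (1::real) \<partial>\<rho> x) \<in> borel_measurable N" by (rule cont[of "\<lambda>_. 1"]) simp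
    then show ?thesis
      by (rule measurable_cong[THEN iffD1, rotated]) (simp add: m_def space)
  qed
  have m_nonneg: "m x \<ge> 0" for x by (simp add: m_def)
  have m_pos: "1 + m x > 0" for x using m_nonneg[of x] by simp
  \<comment> \<open>Rescaling to subprobabilities gives a kernel in the sense of the Giry monad.\<close>
  define K where "K x = density (\<rho> x) (\<lambda>_. ennreal (1 / (1 + m x)))" for x
  have em_K: "emeasure (K x) A = ennreal (measure (\<rho> x) A / (1 + m x))"
    if "x \<in> space N" "A \<in> sets borel" for x A
  proof -
    interpret finite_measure "\<rho> x" using fin that by simp
    have "emeasure (K x) A = ennreal (1 / (1 + m x)) * emeasure (\<rho> x) A"
      unfolding K_def using that by (subst emeasure_density) (auto simp: sets nn_integral_cmult_indicator)
    then show ?thesis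
      using m_pos[of x] by (simp add: emeasure_eq_measure flip: ennreal_mult')
  qed
  have K: "K \<in> measurable N (subprob_algebra borel)"
  proof (rule measurable_subprob_algebra_generated)
    show "sets borel = sigma_sets UNIV (range (\<lambda>a::real. {..a}))"
      by (subst borel_eq_atMost) simp
    show "Int_stable (range (\<lambda>a::real. {..a}))"
      by (auto simp: Int_stable_def)
    fix x assume x: "x \<in> space N"
    show "sets (K x) = sets borel" using x by (simp add: K_def sets)
    show "subprob_space (K x)"
    proof (rule subprob_spaceI)
      have "emeasure (K x) UNIV \<le> 1"
        using m_nonneg[of x] x by (simp add: em_K flip: m_def)
      then show "emeasure (K x) (space (K x)) \<le> 1" by (simp add: K_def space x)
    qed (simp add: K_def space x)
  next
    fix A :: "real set" assume "A \<in> range (\<lambda>a. {..a})"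
    then obtain a where A: "A = {..a}" by auto
    have "(\<lambda>x. ennreal (measure (\<rho> x) {..a} / (1 + m x))) \<in> borel_measurable N"
      using cdf[of a] by measurable
    then show "(\<lambda>x. emeasure (K x) A) \<in> borel_measurable N"
      by (rule measurable_cong[THEN iffD1, rotated]) (simp add: em_K A)
  next
    have "(\<lambda>x. ennreal (m x / (1 + m x))) \<in> borel_measurable N"
      by measurable
    then show "(\<lambda>x. emeasure (K x) UNIV) \<in> borel_measurable N"
      by (rule measurable_cong[THEN iffD1, rotated]) (simp add: em_K m_def)
  qed auto
  have "(\<lambda>x. distr (K x) (N \<Otimes>\<^sub>M borel) (\<lambda>v. (x, v))) \<in> measurable N (subprob_algebra (N \<Otimes>\<^sub>M borel))"
    by (rule measurable_distr2[OF _ K]) measurable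
  then have "(\<lambda>x. \<integral>z. (case z of (x, v) \<Rightarrow> F x v) \<partial>distr (K x) (N \<Otimes>\<^sub>M borel) (\<lambda>v. (x, v))) \<in> borel_measurable N"
    by (rule measurable_compose[OF _ integral_measurable_subprob_algebra[OF F]])
  then have "(\<lambda>x. (1 + m x) * (\<integral>z. (case z of (x, v) \<Rightarrow> F x v)
      \<partial>distr (K x) (N \<Otimes>\<^sub>M borel) (\<lambda>v. (x, v)))) \<in> borel_measurable N"
    by measurable
  then show ?thesis
  proof (rule measurable_cong[THEN iffD1, rotated])
    fix x assume x: "x \<in> space N"
    have Fx: "F x \<in> borel_measurable (\<rho> x)"
      using measurable_compose[OF measurable_Pair1'[OF x] F] sets[OF x]
      by (simp cong: measurable_cong_sets)
    have Px: "(\<lambda>v. (x, v)) \<in> measurable (K x) (N \<Otimes>\<^sub>M borel)"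
      using measurable_Pair1'[OF x, of borel] sets[OF x] by (simp add: K_def cong: measurable_cong_sets)
    have "(\<integral>z. (case z of (x, v) \<Rightarrow> F x v) \<partial>distr (K x) (N \<Otimes>\<^sub>M borel) (\<lambda>v. (x, v))) = (\<integral>v. F x v \<partial>K x)"
      by (subst integral_distr[OF Px F]) simp
    also have "\<dots> = (\<integral>v. F x v / (1 + m x) \<partial>\<rho> x)"
      unfolding K_def using Fx m_pos[of x] by (simp add: integral_density)
    also have "\<dots> = (\<integral>v. F x v \<partial>\<rho> x) / (1 + m x)"
      by simp
    finally show "(1 + m x) * (\<integral>z. (case z of (x, v) \<Rightarrow> F x v) \<partial>distr (K x) (N \<Otimes>\<^sub>M borel) (\<lambda>v. (x, v)))
        = (\<integral>v. F x v \<partial>\<rho> x)"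
      using m_pos[of x] by simp
  qed
qed

section \<open>Integrands of Levy symbols\<close>

text \<open>The integrand of the symbol of a Levy quadruplet.\<close>

definition levy_kernel :: "real \<Rightarrow> real \<Rightarrow> real" where
  "levy_kernel y u = exp (- (u * y)) - 1 + u * y * indicator {-1..1} u"

lemma levy_kernel_measurable [measurable]: "levy_kernel y \<in> borel_measurable borel"
  unfolding levy_kernel_def[abs_def] by measurable

lemma abs_exp_minus_1_le: "\<bar>exp w - 1\<bar> \<le> \<bar>w\<bar> * exp \<bar>w\<bar>" for w :: real
proof (cases "w \<ge> 0")
  case True
  have "exp w * (1 - w) \<le> exp w * exp (- w)"
    using exp_ge_add_one_self[of "- w"] by (intro mult_left_mono) auto
  then have "exp w - 1 \<le> w * exp w" by (simp add: algebra_simps flip: exp_add)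
  then show ?thesis using True by simp
next
  case False
  have "1 - exp w \<le> - w" using exp_ge_add_one_self[of w] by linarith
  also have "\<dots> \<le> - w * exp (- w)" using False by (simp add: mult_le_cancel_left1)
  finally show ?thesis using False by simp
qed

lemma abs_exp_minus_linear_le: "\<bar>exp w - 1 - w\<bar> \<le> w\<^sup>2 * exp \<bar>w\<bar>" for w :: real
proof -
  have "exp w * (1 - w) \<le> exp w * exp (- w)"
    using exp_ge_add_one_self[of "- w"] by (intro mult_left_mono) auto
  then have "exp w - 1 - w \<le> w * (exp w - 1)" by (simp add: algebra_simps flip: exp_add)
  also have "\<dots> \<le> \<bar>w\<bar> * \<bar>exp w - 1\<bar>" by (simp flip: abs_mult)
  also have "\<dots> \<le> \<bar>w\<bar> * (\<bar>w\<bar> * exp \<bar>w\<bar>)" by (intro mult_left_mono abs_exp_minus_1_le) auto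
  also have "\<dots> = w\<^sup>2 * exp \<bar>w\<bar>" by (simp add: power2_eq_square)
  finally show ?thesis using exp_ge_add_one_self[of w] by linarith
qed

lemma abs_levy_kernel_le:
  assumes "0 < y" "- x \<le> u"
  shows "\<bar>levy_kernel y u\<bar> \<le> (y\<^sup>2 * exp y + 1 + exp (x * y)) * min 1 (u\<^sup>2)"
proof (cases "\<bar>u\<bar> \<le> 1")
  case True
  then have u: "u \<in> {-1..1}" "u\<^sup>2 \<le> 1" by (auto simp: abs_square_le_1)
  have "\<bar>levy_kernel y u\<bar> \<le> (u * y)\<^sup>2 * exp \<bar>u * y\<bar>"
    using u abs_exp_minus_linear_le[of "- (u * y)"] by (simp add: levy_kernel_def)
  also have "\<dots> \<le> (u * y)\<^sup>2 * exp y"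
    using True assms by (intro mult_left_mono) (auto simp: abs_mult mult_le_cancel_right1)
  also have "\<dots> \<le> (y\<^sup>2 * exp y + 1 + exp (x * y)) * u\<^sup>2"
    by (simp add: power_mult_distrib algebra_simps)
  finally show ?thesis using u by (simp add: min_absorb2)
next
  case False
  then have u: "u \<notin> {-1..1}" "1 \<le> u\<^sup>2" using abs_square_le_1[of u] by (auto simp: abs_le_iff)
  have "- (u * y) \<le> x * y"
    using mult_right_mono[of "- u" x y] assms by simp
  then have "exp (- (u * y)) \<le> exp (x * y)" by simp
  moreover have "levy_kernel y u = exp (- (u * y)) - 1"
    using u by (simp add: levy_kernel_def)
  moreover have "0 \<le> y\<^sup>2 * exp y" by simp
  ultimately have "\<bar>levy_kernel y u\<bar> \<le> y\<^sup>2 * exp y + 1 + exp (x * y)"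
    using exp_gt_zero[of "- (u * y)"] exp_gt_zero[of "x * y"] by linarith
  then show ?thesis using u by (simp add: min_absorb1)
qed

text \<open>The weights \<open>1 - v\<close> and \<open>(v - p)\<^sup>2\<close>, written in terms of the jump size \<open>u\<close>, dominate the weights in
  the integrability conditions of Levy triplets and quadruplets.\<close>

lemma min_le_one_minus_exp:
  fixes u :: real
  shows "0 \<le> u \<Longrightarrow> min 1 u \<le> 2 * (1 - exp (- u))"
    and "min 1 (u\<^sup>2) \<le> 4 * (exp (- u) - 1)\<^sup>2"
proof -
  have pos: "min 1 u \<le> 2 * (1 - exp (- u))" if "0 \<le> u" for u :: real
  proof -
    define w where "w = min 1 u"
    have w: "0 \<le> w" "w \<le> 1" "w \<le> u" using that by (auto simp: w_def)
    have "exp (- w) * (1 + w) \<le> exp (- w) * exp w"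
      using exp_ge_add_one_self[of w] by (intro mult_left_mono) auto
    then have "w * exp (- w) \<le> 1 - exp (- w)" by (simp add: algebra_simps flip: exp_add)
    moreover have "w * (1 - exp (- w)) \<le> 1 - exp (- w)"
      using w mult_right_mono[of w 1 "1 - exp (- w)"] by simp
    ultimately have "w \<le> 2 * (1 - exp (- w))" by (simp add: algebra_simps)
    also have "\<dots> \<le> 2 * (1 - exp (- u))" using w by simp
    finally show ?thesis by (simp only: w_def)
  qed
  show "0 \<le> u \<Longrightarrow> min 1 u \<le> 2 * (1 - exp (- u))" by (rule pos)
  have "min 1 \<bar>u\<bar> \<le> 2 * \<bar>exp (- u) - 1\<bar>"
  proof (cases "0 \<le> u")
    case True then show ?thesis using pos[of u] by simp
  next
    case False then show ?thesis using exp_ge_add_one_self[of "- u"] by simp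
  qed
  then have "(min 1 \<bar>u\<bar>)\<^sup>2 \<le> (2 * \<bar>exp (- u) - 1\<bar>)\<^sup>2"
    by (intro power_mono) auto
  also have "(min 1 \<bar>u\<bar>)\<^sup>2 = min 1 (u\<^sup>2)"
    using abs_square_le_1[of u] by (auto simp: min_def abs_square_eq_1)
  finally show "min 1 (u\<^sup>2) \<le> 4 * (exp (- u) - 1)\<^sup>2" by (simp add: power_mult_distrib)
qed

lemma integrable_if_dominated:
  fixes g h :: "real \<Rightarrow> real"
  assumes sets: "sets \<nu> = sets (restrict_space borel S)"
    and h: "(\<integral>\<^sup>+u. ennreal (h u) \<partial>\<nu>) < \<infinity>"
    and g: "g \<in> borel_measurable borel" and hm: "h \<in> borel_measurable borel"
    and h0: "\<And>u. u \<in> S \<Longrightarrow> 0 \<le> h u"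
    and le: "\<And>u. u \<in> S \<Longrightarrow> \<bar>g u\<bar> \<le> C * h u"
  shows "integrable \<nu> g"
proof (rule Bochner_Integration.integrable_bound)
  have sp: "space \<nu> = S" using sets_eq_imp_space_eq[OF sets] by (simp add: space_restrict_space)
  have m: "f \<in> borel_measurable \<nu>" if "f \<in> borel_measurable borel" for f :: "real \<Rightarrow> real"
    unfolding measurable_cong_sets[OF sets refl] using that by (rule measurable_restrict_space1)
  have "integrable \<nu> h"
    using h h0 by (intro integrableI_nonneg m hm) (auto simp: sp)
  then show "integrable \<nu> (\<lambda>u. C * h u)" by simp
  show "g \<in> borel_measurable \<nu>" by (rule m[OF g])
  show "AE u in \<nu>. norm (g u) \<le> norm (C * h u)"
    using le by (intro AE_I2) (force simp: sp)
qed

lemma triplet_integrable: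
  assumes "sets N = sets (restrict_space borel {0<..})" "(\<integral>\<^sup>+u. ennreal (min 1 u) \<partial>N) < \<infinity>" and y: "0 < y"
  shows "integrable N (\<lambda>u. exp (- (u * y)) - 1)"
proof (rule integrable_if_dominated[OF assms(1,2)])
  fix u :: real assume "u \<in> {0<..}"
  then have u: "0 < u" by simp
  have "\<bar>exp (- (u * y)) - 1\<bar> = 1 - exp (- (u * y))" using u y by simp
  also have "\<dots> \<le> min 1 (u * y)" using exp_ge_add_one_self[of "- (u * y)"] by simp
  also have "\<dots> \<le> (1 + y) * min 1 u" using u y by (auto simp: min_def algebra_simps)
  finally show "\<bar>exp (- (u * y)) - 1\<bar> \<le> (1 + y) * min 1 u" .
qed auto

lemma levy_symbol_quadruplet:
  "levy_symbol (Levy_Quadruplet \<nu> a b c) y = (\<integral>u. levy_kernel y u \<partial>\<nu>) + a * y\<^sup>2 - b * y - c"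
  by (simp add: levy_kernel_def)

section \<open>Jump measures\<close>

text \<open>The measure \<open>\<rho>(dv) / q(v)\<close> on \<open>v > 0\<close>, transported by \<open>u = - ln v - x\<close>, that is
  \<open>v = exp (- (x + u))\<close>, so that \<open>u\<close> is the size of a jump from \<open>x\<close> to \<open>- ln v\<close>, and then restricted to
  \<open>S\<close>. Where \<open>q\<close> vanishes, the quotient is \<open>0\<close>, hence atoms of \<open>\<rho>\<close> at zeros of \<open>q\<close> leave no trace.\<close>

definition jump_measure :: "real set \<Rightarrow> real \<Rightarrow> (real \<Rightarrow> real) \<Rightarrow> real measure \<Rightarrow> real measure" where
  "jump_measure S x q \<rho> = restrict_space
     (distr (density \<rho> (\<lambda>v. ennreal (indicator {0<..} v / q v))) borel (\<lambda>v. - ln v - x)) S"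

lemma sets_jump_measure: "sets (jump_measure S x q \<rho>) = sets (restrict_space borel S)"
  by (auto simp: jump_measure_def sets_restrict_space)

lemma nn_integral_jump_measure:
  assumes [measurable_cong]: "sets \<rho> = sets borel" and [measurable]: "S \<in> sets borel" "q \<in> borel_measurable borel"
    "g \<in> borel_measurable borel"
  shows "(\<integral>\<^sup>+u. g u \<partial>jump_measure S x q \<rho>) =
    (\<integral>\<^sup>+v. ennreal (indicator {0<..} v / q v) * (g (- ln v - x) * indicator S (- ln v - x)) \<partial>\<rho>)"
  unfolding jump_measure_def
  by (simp add: nn_integral_restrict_space nn_integral_distr nn_integral_density)

lemma integral_jump_measure:
  fixes g :: "real \<Rightarrow> real"
  assumes [measurable_cong]: "sets \<rho> = sets borel" and [measurable]: "S \<in> sets borel" "q \<in> borel_measurable borel"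
    "g \<in> borel_measurable borel" and q: "AE v in \<rho>. q v \<ge> 0"
  shows "(\<integral>u. g u \<partial>jump_measure S x q \<rho>) =
    (\<integral>v. (indicator {0<..} v / q v) * (indicator S (- ln v - x) * g (- ln v - x)) \<partial>\<rho>)"
proof -
  have "(\<integral>u. g u \<partial>jump_measure S x q \<rho>) =
      (\<integral>u. indicator S u * g u \<partial>distr (density \<rho> (\<lambda>v. ennreal (indicator {0<..} v / q v))) borel (\<lambda>v. - ln v - x))"
    unfolding jump_measure_def by (subst integral_restrict_space) auto
  also have "\<dots> = (\<integral>v. indicator S (- ln v - x) * g (- ln v - x)
      \<partial>density \<rho> (\<lambda>v. ennreal (indicator {0<..} v / q v)))"
    by (subst integral_distr) auto
  also have "\<dots> = (\<integral>v. (indicator {0<..} v / q v) *\<^sub>R (indicator S (- ln v - x) * g (- ln v - x)) \<partial>\<rho>)"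
    using q by (subst integral_density) auto
  finally show ?thesis by simp
qed

lemma integrable_jump_measure_iff:
  fixes g :: "real \<Rightarrow> real"
  assumes [measurable_cong]: "sets \<rho> = sets borel" and [measurable]: "S \<in> sets borel" "q \<in> borel_measurable borel"
    "g \<in> borel_measurable borel" and q: "AE v in \<rho>. q v \<ge> 0"
  shows "integrable (jump_measure S x q \<rho>) g \<longleftrightarrow>
    integrable \<rho> (\<lambda>v. (indicator {0<..} v / q v) * (indicator S (- ln v - x) * g (- ln v - x)))"
proof -
  have "integrable (jump_measure S x q \<rho>) g \<longleftrightarrow>
      integrable (distr (density \<rho> (\<lambda>v. ennreal (indicator {0<..} v / q v))) borel (\<lambda>v. - ln v - x)) (\<lambda>u. indicator S u * g u)"
    unfolding jump_measure_def by (subst integrable_restrict_space) auto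
  also have "\<dots> \<longleftrightarrow> integrable (density \<rho> (\<lambda>v. ennreal (indicator {0<..} v / q v))) (\<lambda>v. indicator S (- ln v - x) * g (- ln v - x))"
    by (subst integrable_distr_eq) auto
  also have "\<dots> \<longleftrightarrow> integrable \<rho> (\<lambda>v. (indicator {0<..} v / q v) *\<^sub>R (indicator S (- ln v - x) * g (- ln v - x)))"
    using q by (subst integrable_density) auto
  finally show ?thesis by simp
qed

lemma jump_measure_moment_finite:
  assumes \<rho>: "finite_on 1 \<rho>" and [measurable]: "S \<in> sets borel" "q \<in> borel_measurable borel"
    "h \<in> borel_measurable borel"
    and C: "0 \<le> C"
    and le: "\<And>v. 0 < v \<Longrightarrow> v \<le> 1 \<Longrightarrow> - ln v - x \<in> S \<Longrightarrow> q v \<noteq> 0 \<Longrightarrow> 0 < q v \<and> h (- ln v - x) \<le> C * q v"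
  shows "(\<integral>\<^sup>+u. ennreal (h u) \<partial>jump_measure S x q \<rho>) < \<infinity>"
proof -
  interpret finite_measure \<rho> using finite_onD[OF \<rho>] by simp
  have "(\<integral>\<^sup>+u. ennreal (h u) \<partial>jump_measure S x q \<rho>) =
    (\<integral>\<^sup>+v. ennreal (indicator {0<..} v / q v) * (ennreal (h (- ln v - x)) * indicator S (- ln v - x)) \<partial>\<rho>)"
    using finite_onD(2)[OF \<rho>] by (intro nn_integral_jump_measure) auto
  also have "\<dots> \<le> (\<integral>\<^sup>+v. ennreal C \<partial>\<rho>)"
  proof (rule nn_integral_mono_AE)
    show "AE v in \<rho>. ennreal (indicator {0<..} v / q v) * (ennreal (h (- ln v - x)) * indicator S (- ln v - x)) \<le> ennreal C"
      using finite_onD(3)[OF \<rho>]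
    proof eventually_elim
      case (elim v)
      show ?case
      proof (cases "0 < v \<and> - ln v - x \<in> S \<and> q v \<noteq> 0")
        case True
        then have q: "0 < q v" "h (- ln v - x) \<le> C * q v" using le elim by auto
        then have "1 / q v * h (- ln v - x) \<le> C" by (simp add: field_simps)
        then have "ennreal (1 / q v * h (- ln v - x)) \<le> ennreal C" by (rule ennreal_leI)
        then show ?thesis using True q by (simp flip: ennreal_mult')
      qed (auto split: split_indicator)
    qed
  qed
  also have "\<dots> < \<infinity>"
    using C by (simp add: emeasure_eq_measure ennreal_mult_less_top)
  finally show ?thesis .
qed

section \<open>Symbols at positive finite states\<close>

text \<open>The remainder of the first order Taylor expansion of \<open>v \<mapsto> v powr y\<close> at \<open>p\<close>, divided by
  \<open>(v - p)\<^sup>2\<close>. The value at \<open>p\<close>, half of the second derivative, makes it continuous.\<close>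

definition taylor_quotient :: "real \<Rightarrow> real \<Rightarrow> real \<Rightarrow> real" where
  "taylor_quotient p y v = (if v = p then y * (y - 1) / 2 * p powr (y - 2)
     else (v powr y - p powr y - y * p powr (y - 1) * (v - p)) / (v - p)\<^sup>2)"

lemma taylor_quotient_measurable [measurable]: "taylor_quotient p y \<in> borel_measurable borel"
  unfolding taylor_quotient_def[abs_def] by measurable

lemma continuous_on_taylor_quotient:
  assumes p: "0 < p" and y: "0 < y"
  shows "continuous_on {0..1} (taylor_quotient p y)"
proof -
  let ?f = "\<lambda>v. v powr y - p powr y - y * p powr (y - 1) * (v - p)"
  let ?g = "\<lambda>v. (v - p)\<^sup>2"
  have pos: "\<forall>\<^sub>F v in at p. 0 < v"
    using order_tendstoD(1)[OF tendsto_ident_at p] .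
  have ne: "\<forall>\<^sub>F v in at p. v \<noteq> p" by (rule eventually_neq_at_within)
  have "((\<lambda>v. ?f v / ?g v) \<longlongrightarrow> y * (y - 1) / 2 * p powr (y - 2)) (at p)"
  proof (rule lhopital[where f'="\<lambda>v. y * v powr (y - 1) - y * p powr (y - 1)" and g'="\<lambda>v. 2 * (v - p)"])
    show "(?f \<longlongrightarrow> 0) (at p)"
      using p by (auto intro!: tendsto_eq_intros)
    show "(?g \<longlongrightarrow> 0) (at p)" by (auto intro!: tendsto_eq_intros)
    show "\<forall>\<^sub>F v in at p. ?g v \<noteq> 0" using ne by eventually_elim simp
    show "\<forall>\<^sub>F v in at p. 2 * (v - p) \<noteq> 0" using ne by eventually_elim simp
    show "\<forall>\<^sub>F v in at p. DERIV ?f v :> y * v powr (y - 1) - y * p powr (y - 1)"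
      using pos by eventually_elim (use p in \<open>auto intro!: derivative_eq_intros simp: powr_diff\<close>)
    show "\<forall>\<^sub>F v in at p. DERIV ?g v :> 2 * (v - p)"
      by (intro always_eventually allI) (auto intro!: derivative_eq_intros)
    have "((\<lambda>v. v powr (y - 1)) has_real_derivative (y - 1) * p powr (y - 1 - 1)) (at p)"
      using p by (rule has_real_derivative_powr)
    then have "((\<lambda>v. (v powr (y - 1) - p powr (y - 1)) / (v - p)) \<longlongrightarrow> (y - 1) * p powr (y - 2)) (at p)"
      by (simp add: has_field_derivative_iff)
    then have "((\<lambda>v. y / 2 * ((v powr (y - 1) - p powr (y - 1)) / (v - p))) \<longlongrightarrow> y / 2 * ((y - 1) * p powr (y - 2))) (at p)"
      by (intro tendsto_intros)
    then show "((\<lambda>v. (y * v powr (y - 1) - y * p powr (y - 1)) / (2 * (v - p)))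
        \<longlongrightarrow> y * (y - 1) / 2 * p powr (y - 2)) (at p)"
      by (simp add: algebra_simps diff_divide_distrib)
  qed
  moreover have "\<forall>\<^sub>F v in at p. ?f v / ?g v = taylor_quotient p y v"
    using ne by eventually_elim (simp add: taylor_quotient_def)
  ultimately have "(taylor_quotient p y \<longlongrightarrow> taylor_quotient p y p) (at p)"
    by (simp add: taylor_quotient_def Lim_transform_eventually)
  then have at_p: "isCont (taylor_quotient p y) p" by (simp add: isCont_def)
  have "continuous_on ({0..} - {p}) (\<lambda>v. ?f v / ?g v)"
    using y by (intro continuous_intros continuous_on_powr') auto
  then have off_p: "continuous_on ({0..} - {p}) (taylor_quotient p y)"
    by (rule continuous_on_eq) (auto simp: taylor_quotient_def)
  show ?thesis
    unfolding continuous_on_eq_continuous_within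
  proof
    fix v :: real assume v: "v \<in> {0..1}"
    show "continuous (at v within {0..1}) (taylor_quotient p y)"
    proof (cases "v = p")
      case True then show ?thesis using at_p by (simp add: continuous_at_imp_continuous_at_within)
    next
      case False
      have "continuous (at v within {0..} - {p}) (taylor_quotient p y)"
        using off_p v False by (auto simp: continuous_on_eq_continuous_within)
      moreover have "at v within {0..} - {p} = at v within {0..}"
      proof (rule at_within_nhd[of _ "- {p}"])
        show "v \<in> - {p}" "open (- {p})" using False by auto
      qed auto
      ultimately have "continuous (at v within {0..}) (taylor_quotient p y)" by simp
      then show ?thesis by (rule continuous_within_subset) auto
    qed
  qed
qed

text \<open>The Levy quadruplet at a state \<open>0 < x < \<infinity>\<close>, read off from a measure \<open>\<rho>\<close> on \<open>{0..1}\<close>: with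
  \<open>p = exp (- x)\<close>, the jump measure comes from \<open>\<rho>(dv) / (v - p)\<^sup>2\<close>, the diffusion coefficient from the
  atom at \<open>p\<close>, and the killing rate from the atom at \<open>0\<close>, which stands for jumps to infinity. The
  number \<open>A\<close>, to be thought of as the generator applied to \<open>exp_fun 1\<close> at \<open>x\<close>, fixes the drift, including the
  compensation of small jumps.\<close>

definition quadruplet_of :: "real \<Rightarrow> real measure \<Rightarrow> real \<Rightarrow> levy_data" where
  "quadruplet_of x \<rho> A =
    (let p = exp (- x); \<nu> = jump_measure {- x..} x (\<lambda>v. (v - p)\<^sup>2) \<rho>;
         a = measure \<rho> {p} / (2 * p\<^sup>2); c = measure \<rho> {0} / p\<^sup>2
     in Levy_Quadruplet \<nu> a ((\<integral>u. levy_kernel 1 u \<partial>\<nu>) - exp x * A - c + a) c)"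

lemma quadruplet_of_correct:
  assumes x: "0 < x" and \<rho>: "finite_on 1 \<rho>"
    and L: "\<And>y. 0 < y \<Longrightarrow> L y = y * exp (- x) powr (y - 1) * L 1 + (\<integral>v. taylor_quotient (exp (- x)) y v \<partial>\<rho>)"
  shows "is_levy_quadruplet x (quadruplet_of x \<rho> (L 1))"
    and "0 < y \<Longrightarrow> L y = levy_symbol (quadruplet_of x \<rho> (L 1)) y * exp (- (x * y))"
proof -
  define p where "p = exp (- x)"
  have p: "0 < p" "p < 1" "exp x = 1 / p" "ln p = - x"
    using x by (simp_all add: p_def, simp add: exp_minus divide_inverse)
  define q where "q v = (v - p)\<^sup>2" for v
  have [measurable]: "q \<in> borel_measurable borel" unfolding q_def[abs_def] by measurable
  define \<nu> where "\<nu> = jump_measure {- x..} x q \<rho>"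
  define a where "a = measure \<rho> {p} / (2 * p\<^sup>2)"
  define c where "c = measure \<rho> {0} / p\<^sup>2"
  interpret finite_measure \<rho> using finite_onD[OF \<rho>] by simp
  note [measurable_cong] = finite_onD(2)[OF \<rho>]
  note [simp] = finite_onD(2,4)[OF \<rho>]
  have [simp]: "integrable \<rho> (indicat_real {b})" for b
    by (rule integrable_real_indicator) (auto simp: less_top[symmetric])
  have Q: "quadruplet_of x \<rho> (L 1) =
      Levy_Quadruplet \<nu> a ((\<integral>u. levy_kernel 1 u \<partial>\<nu>) - exp x * L 1 - c + a) c"
    by (simp add: quadruplet_of_def Let_def \<nu>_def a_def c_def p_def q_def[abs_def])
  have sets_\<nu>: "sets \<nu> = sets (restrict_space borel {- x..})" by (simp add: \<nu>_def sets_jump_measure)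
  have exp_jump: "exp (- (- ln v - x)) = v / p" if "0 < v" for v
    using that p by (simp add: exp_add)
  have fin: "(\<integral>\<^sup>+u. ennreal (min 1 (u\<^sup>2)) \<partial>\<nu>) < \<infinity>"
    unfolding \<nu>_def
  proof (rule jump_measure_moment_finite[where C="4 / p\<^sup>2", OF \<rho>])
    fix v :: real assume v: "0 < v" "v \<le> 1" "q v \<noteq> 0"
    have "min 1 ((- ln v - x)\<^sup>2) \<le> 4 * (v / p - 1)\<^sup>2"
      using min_le_one_minus_exp(2)[of "- ln v - x"] exp_jump[OF v(1)] by simp
    also have "\<dots> = 4 / p\<^sup>2 * q v" using p by (simp add: q_def field_simps power2_eq_square)
    finally show "0 < q v \<and> min 1 ((- ln v - x)\<^sup>2) \<le> 4 / p\<^sup>2 * q v"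
      using v by (simp add: q_def)
  qed auto
  have "emeasure \<nu> {0} = (\<integral>\<^sup>+u. indicator {0} u \<partial>\<nu>)"
    using x by (subst nn_integral_indicator) (auto simp: sets_\<nu> sets_restrict_space_iff)
  also have "\<dots> = (\<integral>\<^sup>+v. ennreal (indicator {0<..} v / q v) * (indicator {0} (- ln v - x) * indicator {- x..} (- ln v - x)) \<partial>\<rho>)"
    unfolding \<nu>_def by (rule nn_integral_jump_measure) auto
  also have "\<dots> = (\<integral>\<^sup>+v. 0 \<partial>\<rho>)"
  proof (rule nn_integral_cong)
    fix v
    show "ennreal (indicator {0<..} v / q v) * (indicator {0} (- ln v - x) * indicator {- x..} (- ln v - x)) = 0"
    proof (cases "0 < v \<and> - ln v - x = 0")
      case True
      then have "v = p" using exp_jump[of v] p by (simp add: field_simps)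
      then show ?thesis by (simp add: q_def)
    qed (auto split: split_indicator)
  qed
  finally have "emeasure \<nu> {0} = 0" by simp
  then show "is_levy_quadruplet x (quadruplet_of x \<rho> (L 1))"
    using fin by (simp add: Q sets_\<nu> a_def c_def)
  have int_kernel: "integrable \<nu> (levy_kernel y)" if "0 < y" for y
    using abs_levy_kernel_le[OF that, of x] by (intro integrable_if_dominated[OF sets_\<nu> fin]) auto
  assume y: "0 < y"
  let ?K = "\<lambda>u. levy_kernel y u - y * levy_kernel 1 u"
  let ?J = "\<lambda>v. (indicator {0<..} v / q v) * (indicator {- x..} (- ln v - x) * ?K (- ln v - x))"
  have K: "integrable \<nu> ?K" using int_kernel y by auto
  have qp: "AE v in \<rho>. 0 \<le> q v" by (simp add: q_def)
  have J: "integrable \<rho> ?J"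
    using K unfolding \<nu>_def by (subst (asm) integrable_jump_measure_iff) (use qp in auto)
  have intJ: "(\<integral>v. ?J v \<partial>\<rho>) = (\<integral>u. levy_kernel y u \<partial>\<nu>) - y * (\<integral>u. levy_kernel 1 u \<partial>\<nu>)"
  proof -
    have "(\<integral>v. ?J v \<partial>\<rho>) = (\<integral>u. ?K u \<partial>\<nu>)"
      unfolding \<nu>_def using qp by (subst integral_jump_measure) auto
    then show ?thesis using int_kernel y by simp
  qed
  have pe: "p powr y * exp (x * y) = 1"
    by (simp add: p_def powr_def flip: exp_add)
  \<comment> \<open>The atoms at \<open>0\<close> and at \<open>p\<close> produce killing and diffusion.\<close>
  have decomp: "AE v in \<rho>. exp (x * y) * taylor_quotient p y v =
      ?J v + (y - 1) / p\<^sup>2 * indicator {0} v + y * (y - 1) / (2 * p\<^sup>2) * indicator {p} v"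
    using finite_onD(3)[OF \<rho>]
  proof eventually_elim
    case (elim v)
    consider "v = 0" | "v = p" | "0 < v" "v \<noteq> p" using elim by force
    then show ?case
    proof cases
      case 1
      have "taylor_quotient p y 0 = p powr y * (y - 1) / p\<^sup>2"
        using p y by (simp add: taylor_quotient_def powr_diff field_simps power2_eq_square)
      then have "exp (x * y) * taylor_quotient p y 0 = (p powr y * exp (x * y)) * ((y - 1) / p\<^sup>2)"
        by simp
      then show ?thesis using 1 p pe by simp
    next
      case 2
      have "taylor_quotient p y p = p powr y * (y * (y - 1) / (2 * p\<^sup>2))"
        using p by (simp add: taylor_quotient_def powr_diff)
      then have "exp (x * y) * taylor_quotient p y p = (p powr y * exp (x * y)) * (y * (y - 1) / (2 * p\<^sup>2))"
        by simp
      then show ?thesis using 2 p pe by (simp add: q_def)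
    next
      case 3
      have S: "- x \<le> - ln v - x" using elim 3 by simp
      have e: "exp (- ((- ln v - x) * z)) = v powr z * exp (x * z)" for z
        using 3 by (simp add: powr_def algebra_simps flip: exp_add)
      have "?K (- ln v - x) = (v powr y * exp (x * y) - 1) - y * (v * exp x - 1)"
        using e[of y] e[of 1] 3 by (simp add: levy_kernel_def algebra_simps)
      also have "\<dots> = exp (x * y) * (v powr y - p powr y - y * p powr (y - 1) * (v - p))"
      proof -
        have "p powr (y - 1) = p powr y / p" using p by (simp add: powr_diff)
        then have "exp (x * y) * (v powr y - p powr y - y * p powr (y - 1) * (v - p)) =
            exp (x * y) * v powr y - (p powr y * exp (x * y)) - y * (p powr y * exp (x * y)) * (v / p - 1)"
          using p by (simp add: algebra_simps diff_divide_distrib)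
        then show ?thesis
          using p pe by (simp add: algebra_simps)
      qed
      finally show ?thesis
        using 3 S by (simp add: taylor_quotient_def q_def)
    qed
  qed
  have "exp (x * y) * (\<integral>v. taylor_quotient p y v \<partial>\<rho>) = (\<integral>v. exp (x * y) * taylor_quotient p y v \<partial>\<rho>)"
    by simp
  also have "\<dots> = (\<integral>v. ?J v + (y - 1) / p\<^sup>2 * indicator {0} v + y * (y - 1) / (2 * p\<^sup>2) * indicator {p} v \<partial>\<rho>)"
    by (rule integral_cong_AE[OF _ _ decomp]) auto
  also have "\<dots> = (\<integral>v. ?J v \<partial>\<rho>) + (y - 1) / p\<^sup>2 * measure \<rho> {0} + y * (y - 1) / (2 * p\<^sup>2) * measure \<rho> {p}"
    using J by simp
  also have "\<dots> = (\<integral>u. levy_kernel y u \<partial>\<nu>) - y * (\<integral>u. levy_kernel 1 u \<partial>\<nu>) + (y - 1) * c + y * (y - 1) * a"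
    unfolding intJ using p by (simp add: a_def c_def field_simps)
  finally have *: "exp (x * y) * (\<integral>v. taylor_quotient p y v \<partial>\<rho>) =
    (\<integral>u. levy_kernel y u \<partial>\<nu>) - y * (\<integral>u. levy_kernel 1 u \<partial>\<nu>) + (y - 1) * c + y * (y - 1) * a" .
  have "exp (x * y) * p powr (y - 1) = exp x"
    using p pe by (simp add: powr_diff field_simps)
  then have "exp (x * y) * L y = y * exp x * L 1 + exp (x * y) * (\<integral>v. taylor_quotient p y v \<partial>\<rho>)"
    by (subst L[OF y]) (simp add: p_def algebra_simps)
  also have "\<dots> = levy_symbol (quadruplet_of x \<rho> (L 1)) y"
    unfolding * Q levy_symbol_quadruplet by (simp add: algebra_simps power2_eq_square)
  finally show "L y = levy_symbol (quadruplet_of x \<rho> (L 1)) y * exp (- (x * y))"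
    by (simp add: exp_minus field_simps)
qed

section \<open>Symbols at zero\<close>

text \<open>The slope of the chord of \<open>v \<mapsto> v powr y\<close> between \<open>v\<close> and \<open>1\<close>, continuously extended to \<open>v = 1\<close>.\<close>

definition slope_quotient :: "real \<Rightarrow> real \<Rightarrow> real" where
  "slope_quotient y v = (if v = 1 then y else (1 - v powr y) / (1 - v))"

lemma slope_quotient_measurable [measurable]: "slope_quotient y \<in> borel_measurable borel"
  unfolding slope_quotient_def[abs_def] by measurable

lemma continuous_on_slope_quotient:
  assumes y: "0 < y"
  shows "continuous_on {0..1} (slope_quotient y)"
proof -
  have "((\<lambda>v. v powr y) has_real_derivative y) (at 1)"
    using has_real_derivative_powr[of 1 y] by simp
  then have "((\<lambda>v. (v powr y - 1) / (v - 1)) \<longlongrightarrow> y) (at 1)"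
    by (simp add: has_field_derivative_iff)
  moreover have "\<forall>\<^sub>F v in at 1. (v powr y - 1) / (v - 1) = slope_quotient y v"
    using eventually_neq_at_within[of 1]
    by eventually_elim (simp add: slope_quotient_def minus_divide_right[symmetric] divide_simps, simp add: algebra_simps)
  ultimately have "(slope_quotient y \<longlongrightarrow> slope_quotient y 1) (at 1)"
    by (simp add: slope_quotient_def Lim_transform_eventually)
  then have at_1: "isCont (slope_quotient y) 1" by (simp add: isCont_def)
  have "continuous_on {0..<1} (\<lambda>v. (1 - v powr y) / (1 - v))"
    using y by (intro continuous_intros continuous_on_powr') auto
  then have off_1: "continuous_on {0..<1} (slope_quotient y)"
    by (rule continuous_on_eq) (auto simp: slope_quotient_def)
  show ?thesis
    unfolding continuous_on_eq_continuous_within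
  proof
    fix v :: real assume v: "v \<in> {0..1}"
    show "continuous (at v within {0..1}) (slope_quotient y)"
    proof (cases "v = 1")
      case True then show ?thesis using at_1 by (simp add: continuous_at_imp_continuous_at_within)
    next
      case False
      have "continuous (at v within {0..<1}) (slope_quotient y)"
        using off_1 v False by (auto simp: continuous_on_eq_continuous_within)
      moreover have "at v within {0..<1} = at v within {0..1}"
        by (rule at_within_nhd[of _ "{..<1}"]) (use v False in auto)
      ultimately show ?thesis by simp
    qed
  qed
qed

text \<open>In the triplet that is found, the atoms of \<open>\<rho>\<close> at \<open>0\<close> and at \<open>1\<close> are the killing rate and the drift.\<close>

lemma triplet_exists:
  assumes \<rho>: "finite_on 1 \<rho>"
    and L: "\<And>y. 0 < y \<Longrightarrow> L y = - (\<integral>v. slope_quotient y v \<partial>\<rho>)"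
  obtains l where "is_levy_triplet l" "\<And>y. 0 < y \<Longrightarrow> L y = levy_symbol l y"
proof -
  define q where "q v = 1 - v" for v :: real
  have [measurable]: "q \<in> borel_measurable borel" unfolding q_def[abs_def] by measurable
  define \<nu> where "\<nu> = jump_measure {0<..} 0 q \<rho>"
  interpret finite_measure \<rho> using finite_onD[OF \<rho>] by simp
  note [measurable_cong] = finite_onD(2)[OF \<rho>]
  note [simp] = finite_onD(2,4)[OF \<rho>]
  have [simp]: "integrable \<rho> (indicat_real {b})" for b
    by (rule integrable_real_indicator) (auto simp: less_top[symmetric])
  have sets_\<nu>: "sets \<nu> = sets (restrict_space borel {0<..})" by (simp add: \<nu>_def sets_jump_measure)
  have fin: "(\<integral>\<^sup>+u. ennreal (min 1 u) \<partial>\<nu>) < \<infinity>"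
    unfolding \<nu>_def
  proof (rule jump_measure_moment_finite[where C=2, OF \<rho>])
    fix v :: real assume v: "0 < v" "v \<le> 1" "q v \<noteq> 0"
    have "min 1 (- ln v - 0) \<le> 2 * (1 - v)"
      using min_le_one_minus_exp(1)[of "- ln v"] v by simp
    then show "0 < q v \<and> min 1 (- ln v - 0) \<le> 2 * q v" using v by (simp add: q_def)
  qed auto
  define l where "l = Levy_Triplet \<nu> (measure \<rho> {1}) (measure \<rho> {0})"
  have lev: "is_levy_triplet l" using fin by (simp add: l_def sets_\<nu>)
  have "L y = levy_symbol l y" if y: "0 < y" for y
  proof -
    let ?K = "\<lambda>u. exp (- (u * y)) - 1"
    let ?J = "\<lambda>v. (indicator {0<..} v / q v) * (indicator {0<..} (- ln v - 0) * ?K (- ln v - 0))"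
    have qp: "AE v in \<rho>. 0 \<le> q v" by (rule AE_pos_weight[OF \<rho>]) (simp add: q_def)
    have K: "integrable \<nu> ?K" using sets_\<nu> fin y by (rule triplet_integrable)
    have J: "integrable \<rho> ?J"
      using K unfolding \<nu>_def by (subst (asm) integrable_jump_measure_iff) (use qp in auto)
    have intJ: "(\<integral>v. ?J v \<partial>\<rho>) = (\<integral>u. ?K u \<partial>\<nu>)"
      unfolding \<nu>_def using qp by (subst integral_jump_measure) auto
    have "AE v in \<rho>. - slope_quotient y v = ?J v - indicator {0} v - y * indicator {1} v"
      using finite_onD(3)[OF \<rho>]
    proof eventually_elim
      case (elim v)
      consider "v = 0" | "v = 1" | "0 < v" "v < 1" using elim by force
      then show ?case
      proof cases
        case 3
        then have "exp (- (- ln v * y)) = v powr y" "ln v < 0" by (simp_all add: powr_def mult.commute)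
        then show ?thesis using 3 by (simp add: slope_quotient_def q_def field_simps)
      qed (use y in \<open>auto simp: slope_quotient_def\<close>)
    qed
    then have "(\<integral>v. - slope_quotient y v \<partial>\<rho>) = (\<integral>v. ?J v - indicator {0} v - y * indicator {1} v \<partial>\<rho>)"
      by (intro integral_cong_AE) auto
    also have "\<dots> = (\<integral>v. ?J v \<partial>\<rho>) - measure \<rho> {0} - y * measure \<rho> {1}"
      using J by simp
    finally show ?thesis
      using L[OF y] intJ by (simp add: l_def)
  qed
  with lev show ?thesis using that by blast
qed

section \<open>Symbols at infinity\<close>

text \<open>Here \<open>v = 1\<close> is the state \<open>0\<close>, hence the atom of \<open>\<rho>\<close> at \<open>1\<close> is the mass of jumps to \<open>0\<close>. An atom
  at \<open>0\<close> is ignored.\<close>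

lemma pair_exists:
  assumes \<rho>: "finite_on 1 \<rho>"
    and int: "\<And>y. 0 < y \<Longrightarrow> integrable \<rho> (\<lambda>v. indicator {0<..} v * v powr (y - 1))"
    and L: "\<And>y. 0 < y \<Longrightarrow> L y = (\<integral>v. indicator {0<..} v * v powr (y - 1) \<partial>\<rho>)"
  obtains l where "is_levy_pair l" "\<And>y. 0 < y \<Longrightarrow> L y = levy_symbol l y"
proof -
  define \<nu> where "\<nu> = jump_measure {0<..} 0 (\<lambda>v. v) \<rho>"
  interpret finite_measure \<rho> using finite_onD[OF \<rho>] by simp
  note [measurable_cong] = finite_onD(2)[OF \<rho>]
  note [simp] = finite_onD(2,4)[OF \<rho>]
  have [simp]: "integrable \<rho> (indicat_real {b})" for b
    by (rule integrable_real_indicator) (auto simp: less_top[symmetric])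
  have sets_\<nu>: "sets \<nu> = sets (restrict_space borel {0<..})" by (simp add: \<nu>_def sets_jump_measure)
  have qp: "AE v in \<rho>. 0 \<le> v" by (rule AE_pos_weight[OF \<rho>])
  define l where "l = Levy_Pair \<nu> (measure \<rho> {1})"
  let ?J = "\<lambda>y v. (indicator {0<..} v / v) * (indicator {0<..} (- ln v - 0) * exp (- ((- ln v - 0) * y)))"
  have decomp: "AE v in \<rho>. ?J y v = indicator {0<..} v * v powr (y - 1) - indicator {1} v" for y
    using finite_onD(3)[OF \<rho>]
  proof eventually_elim
    case (elim v)
    consider "v = 0" | "v = 1" | "0 < v" "v < 1" using elim by force
    then show ?case
    proof cases
      case 3
      then have "exp (- (- ln v * y)) = v powr y" "ln v < 0" by (simp_all add: powr_def mult.commute)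
      then show ?thesis using 3 by (simp add: powr_diff)
    qed auto
  qed
  have J: "integrable \<rho> (?J y)" if y: "0 < y" for y
  proof (rule integrable_cong_AE_imp)
    show "integrable \<rho> (\<lambda>v. indicator {0<..} v * v powr (y - 1) - indicator {1} v)"
      using int[OF y] by simp
    show "AE v in \<rho>. indicator {0<..} v * v powr (y - 1) - indicator {1} v = ?J y v"
      using decomp[of y] by eventually_elim simp
  qed auto
  have K: "integrable \<nu> (\<lambda>u. exp (- (u * y)))" if y: "0 < y" for y
    unfolding \<nu>_def using J[OF y] qp by (subst integrable_jump_measure_iff) auto
  have "(\<integral>\<^sup>+u. ennreal (exp (- (u * y))) \<partial>\<nu>) < \<infinity>" if y: "0 < y" for y
    using K[OF y] by (simp add: nn_integral_eq_integral)
  then have lev: "is_levy_pair l" by (simp add: l_def sets_\<nu>)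
  have "L y = levy_symbol l y" if y: "0 < y" for y
  proof -
    have "(\<integral>u. exp (- (u * y)) \<partial>\<nu>) = (\<integral>v. ?J y v \<partial>\<rho>)"
      unfolding \<nu>_def using qp by (subst integral_jump_measure) auto
    also have "\<dots> = (\<integral>v. indicator {0<..} v * v powr (y - 1) - indicator {1} v \<partial>\<rho>)"
      by (rule integral_cong_AE[OF _ _ decomp]) auto
    also have "\<dots> = L y - measure \<rho> {1}"
      using int[OF y] L[OF y] by simp
    finally show ?thesis by (simp add: l_def)
  qed
  with lev show ?thesis using that by blast
qed

section \<open>Limits of difference quotients\<close>

text \<open>The situation at a single state: \<open>\<mu> n\<close> is the law of \<open>exp (- X t)\<close> at a small time \<open>t = 1 / s n\<close>, and
  \<open>p = exp (- x)\<close> for the starting point \<open>x\<close>. Then \<open>G y\<close> is the generator applied to \<open>exp_fun y\<close>.\<close>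

locale exponential_limits =
  fixes \<mu> :: "nat \<Rightarrow> real measure" and s :: "nat \<Rightarrow> real" and p :: real and G :: "real \<Rightarrow> real"
  assumes fin: "\<And>n. finite_on 1 (\<mu> n)" and mass: "\<And>n. measure (\<mu> n) UNIV = 1"
    and s_nonneg: "\<And>n. 0 \<le> s n" and p01: "0 \<le> p" "p \<le> 1"
    and lim: "\<And>y. 0 < y \<Longrightarrow> (\<lambda>n. s n * ((\<integral>v. v powr y \<partial>\<mu> n) - p powr y)) \<longlonglongrightarrow> G y"
begin

lemma integrable_unit:
  "f \<in> borel_measurable borel \<Longrightarrow> continuous_on {0..1} f \<Longrightarrow> integrable (\<mu> n) (f :: real \<Rightarrow> real)"
  by (rule finite_on_integrable[OF fin])

lemma integrable_power: "integrable (\<mu> n) (\<lambda>v. v ^ k)"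
  by (intro integrable_unit continuous_intros) auto

lemma integrable_const: "integrable (\<mu> n) (\<lambda>v. C :: real)"
  by (intro integrable_unit continuous_intros) auto

lemma integral_cong_unit:
  assumes "f \<in> borel_measurable borel" "g \<in> borel_measurable borel" "\<And>v. 0 \<le> v \<Longrightarrow> v \<le> 1 \<Longrightarrow> f v = g v"
  shows "(\<integral>v. f v \<partial>\<mu> n) = (\<integral>v. g v \<partial>\<mu> n :: real)"
proof (rule integral_cong_AE)
  show "AE v in \<mu> n. f v = g v"
    using finite_onD(3)[OF fin[of n]] by eventually_elim (use assms(3) in auto)
qed (use assms in \<open>simp_all add: measurable_cong_sets[OF finite_onD(2)[OF fin] refl]\<close>)

text \<open>The values of \<open>G\<close> at the natural numbers. At exponent \<open>0\<close> the difference quotient is identically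
  \<open>0\<close>, since \<open>\<mu> n\<close> has mass one.\<close>

definition D :: "nat \<Rightarrow> real" where "D k = (if k = 0 then 0 else G (real k))"

lemma power_lim: "(\<lambda>n. s n * ((\<integral>v. v ^ k \<partial>\<mu> n) - p ^ k)) \<longlonglongrightarrow> D k"
proof (cases "k = 0")
  case True then show ?thesis by (simp add: D_def finite_onD(4)[OF fin] mass)
next
  case False
  have "(\<integral>v. v powr real k \<partial>\<mu> n) = (\<integral>v. v ^ k \<partial>\<mu> n)" for n
    using False by (intro integral_cong_unit) (auto simp: powr_realpow')
  moreover have "p powr real k = p ^ k" using False p01 by (simp add: powr_realpow')
  ultimately show ?thesis using lim[of "real k"] False by (simp add: D_def)
qed

lemma second_order_limit:
  assumes p: "0 < p"
  obtains \<rho> where "finite_on 1 \<rho>"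
    "\<And>f :: real \<Rightarrow> real. f \<in> borel_measurable borel \<Longrightarrow> continuous_on {0..1} f \<Longrightarrow>
      (\<lambda>n. s n * (\<integral>v. (v - p)\<^sup>2 * f v \<partial>\<mu> n)) \<longlonglongrightarrow> (\<integral>v. f v \<partial>\<rho>)"
    "\<And>y. 0 < y \<Longrightarrow> G y = y * p powr (y - 1) * G 1 + (\<integral>v. taylor_quotient p y v \<partial>\<rho>)"
proof -
  have mom: "(\<lambda>n. s n * (\<integral>v. (v - p)\<^sup>2 * v ^ k \<partial>\<mu> n)) \<longlonglongrightarrow> D (k + 2) - 2 * p * D (k + 1) + p\<^sup>2 * D k" for k
  proof -
    have "(\<integral>v. (v - p)\<^sup>2 * v ^ k \<partial>\<mu> n) = (\<integral>v. v ^ (k + 2) - 2 * p * v ^ (k + 1) + p\<^sup>2 * v ^ k \<partial>\<mu> n)" for n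
      by (rule Bochner_Integration.integral_cong) (auto simp: power2_eq_square algebra_simps)
    also have "\<dots> n = (\<integral>v. v ^ (k + 2) \<partial>\<mu> n) - 2 * p * (\<integral>v. v ^ (k + 1) \<partial>\<mu> n) + p\<^sup>2 * (\<integral>v. v ^ k \<partial>\<mu> n)" for n
      using integrable_power by (intro integral_combination)
    finally have e: "(\<integral>v. (v - p)\<^sup>2 * v ^ k \<partial>\<mu> n) =
      (\<integral>v. v ^ (k + 2) \<partial>\<mu> n) - 2 * p * (\<integral>v. v ^ (k + 1) \<partial>\<mu> n) + p\<^sup>2 * (\<integral>v. v ^ k \<partial>\<mu> n)" for n .
    have "s n * (\<integral>v. (v - p)\<^sup>2 * v ^ k \<partial>\<mu> n) =
        s n * ((\<integral>v. v ^ (k + 2) \<partial>\<mu> n) - p ^ (k + 2)) - 2 * p * (s n * ((\<integral>v. v ^ (k + 1) \<partial>\<mu> n) - p ^ (k + 1)))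
        + p\<^sup>2 * (s n * ((\<integral>v. v ^ k \<partial>\<mu> n) - p ^ k))" for n
      unfolding e by (simp add: power2_eq_square algebra_simps)
    then show ?thesis by (simp only:) (intro tendsto_intros power_lim)
  qed
  have q: "(\<lambda>v. (v - p)\<^sup>2) \<in> borel_measurable borel" "continuous_on {0..1} (\<lambda>v. (v - p)\<^sup>2)"
    "\<And>v. 0 \<le> v \<Longrightarrow> v \<le> 1 \<Longrightarrow> 0 \<le> (v - p)\<^sup>2"
    by (auto intro!: continuous_intros)
  obtain \<rho> where \<rho>: "finite_on 1 \<rho>"
    "\<And>f :: real \<Rightarrow> real. f \<in> borel_measurable borel \<Longrightarrow> continuous_on {0..1} f \<Longrightarrow>
      (\<lambda>n. s n * (\<integral>v. (v - p)\<^sup>2 * f v \<partial>\<mu> n)) \<longlonglongrightarrow> (\<integral>v. f v \<partial>\<rho>)"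
    using weighted_limit_measure[OF fin s_nonneg q mom] by blast
  have "G y = y * p powr (y - 1) * G 1 + (\<integral>v. taylor_quotient p y v \<partial>\<rho>)" if y: "0 < y" for y
  proof (rule LIMSEQ_unique[OF lim[OF y]])
    have T: "integrable (\<mu> n) (\<lambda>v. (v - p)\<^sup>2 * taylor_quotient p y v)" for n
      by (intro integrable_unit continuous_intros continuous_on_taylor_quotient p y) auto
    have "(\<integral>v. v powr y \<partial>\<mu> n) =
        (\<integral>v. p powr y + y * p powr (y - 1) * (v - p) + (v - p)\<^sup>2 * taylor_quotient p y v \<partial>\<mu> n)" for n
      by (rule integral_cong_unit) (auto simp: taylor_quotient_def)
    also have "\<dots> n = p powr y + y * p powr (y - 1) * ((\<integral>v. v ^ 1 \<partial>\<mu> n) - p)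
        + (\<integral>v. (v - p)\<^sup>2 * taylor_quotient p y v \<partial>\<mu> n)" for n
      using integrable_power[of n 1] T[of n] integrable_const[of n] by (simp add: finite_onD(4)[OF fin] mass)
    finally have e: "(\<integral>v. v powr y \<partial>\<mu> n) = p powr y + y * p powr (y - 1) * ((\<integral>v. v ^ 1 \<partial>\<mu> n) - p)
        + (\<integral>v. (v - p)\<^sup>2 * taylor_quotient p y v \<partial>\<mu> n)" for n .
    have "s n * ((\<integral>v. v powr y \<partial>\<mu> n) - p powr y) =
       y * p powr (y - 1) * (s n * ((\<integral>v. v ^ 1 \<partial>\<mu> n) - p ^ 1)) + s n * (\<integral>v. (v - p)\<^sup>2 * taylor_quotient p y v \<partial>\<mu> n)" for n
      unfolding e by (simp add: distrib_left mult.left_commute)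
    moreover have "D 1 = G 1" by (simp add: D_def)
    ultimately show "(\<lambda>n. s n * ((\<integral>v. v powr y \<partial>\<mu> n) - p powr y))
        \<longlonglongrightarrow> y * p powr (y - 1) * G 1 + (\<integral>v. taylor_quotient p y v \<partial>\<rho>)"
      using power_lim[of 1] \<rho>(2)[OF taylor_quotient_measurable continuous_on_taylor_quotient[OF p y]]
      by (simp only:) (intro tendsto_intros, simp_all)
  qed
  then show ?thesis using \<rho> that by blast
qed

lemma triplet_limit:
  assumes p: "p = 1"
  obtains l where "is_levy_triplet l" "\<And>y. 0 < y \<Longrightarrow> G y = levy_symbol l y"
proof -
  have mom: "(\<lambda>n. s n * (\<integral>v. (1 - v) * v ^ k \<partial>\<mu> n)) \<longlonglongrightarrow> D k - D (k + 1)" for k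
  proof -
    have "(\<integral>v. (1 - v) * v ^ k \<partial>\<mu> n) = (\<integral>v. v ^ k - v ^ (k + 1) \<partial>\<mu> n)" for n
      by (rule Bochner_Integration.integral_cong) (auto simp: algebra_simps)
    also have "\<dots> n = (\<integral>v. v ^ k \<partial>\<mu> n) - (\<integral>v. v ^ (k + 1) \<partial>\<mu> n)" for n
      using integrable_power by (intro Bochner_Integration.integral_diff)
    finally have e: "(\<integral>v. (1 - v) * v ^ k \<partial>\<mu> n) = (\<integral>v. v ^ k \<partial>\<mu> n) - (\<integral>v. v ^ (k + 1) \<partial>\<mu> n)" for n .
    have "s n * (\<integral>v. (1 - v) * v ^ k \<partial>\<mu> n) =
        s n * ((\<integral>v. v ^ k \<partial>\<mu> n) - p ^ k) - s n * ((\<integral>v. v ^ (k + 1) \<partial>\<mu> n) - p ^ (k + 1))" for n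
      unfolding e by (simp add: p algebra_simps)
    then show ?thesis by (simp only:) (intro tendsto_intros power_lim)
  qed
  have q: "(\<lambda>v::real. 1 - v) \<in> borel_measurable borel" "continuous_on {0..1} (\<lambda>v::real. 1 - v)"
    "\<And>v::real. 0 \<le> v \<Longrightarrow> v \<le> 1 \<Longrightarrow> 0 \<le> 1 - v"
    by (auto intro!: continuous_intros)
  obtain \<rho> where \<rho>: "finite_on 1 \<rho>"
    "\<And>f :: real \<Rightarrow> real. f \<in> borel_measurable borel \<Longrightarrow> continuous_on {0..1} f \<Longrightarrow>
      (\<lambda>n. s n * (\<integral>v. (1 - v) * f v \<partial>\<mu> n)) \<longlonglongrightarrow> (\<integral>v. f v \<partial>\<rho>)"
    using weighted_limit_measure[OF fin s_nonneg q mom] by blast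
  have "G y = - (\<integral>v. slope_quotient y v \<partial>\<rho>)" if y: "0 < y" for y
  proof (rule LIMSEQ_unique[OF lim[OF y]])
    have T: "integrable (\<mu> n) (\<lambda>v. (1 - v) * slope_quotient y v)" for n
      by (intro integrable_unit continuous_intros continuous_on_slope_quotient y) auto
    have "(\<integral>v. v powr y \<partial>\<mu> n) = (\<integral>v. 1 - (1 - v) * slope_quotient y v \<partial>\<mu> n)" for n
      by (rule integral_cong_unit) (auto simp: slope_quotient_def)
    also have "\<dots> n = 1 - (\<integral>v. (1 - v) * slope_quotient y v \<partial>\<mu> n)" for n
      using T[of n] integrable_const[of n] by (simp add: finite_onD(4)[OF fin] mass)
    finally have e: "(\<integral>v. v powr y \<partial>\<mu> n) = 1 - (\<integral>v. (1 - v) * slope_quotient y v \<partial>\<mu> n)" for n .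
    have "s n * ((\<integral>v. v powr y \<partial>\<mu> n) - p powr y) = - (s n * (\<integral>v. (1 - v) * slope_quotient y v \<partial>\<mu> n))" for n
      unfolding e by (simp add: p)
    then show "(\<lambda>n. s n * ((\<integral>v. v powr y \<partial>\<mu> n) - p powr y)) \<longlonglongrightarrow> - (\<integral>v. slope_quotient y v \<partial>\<rho>)"
      using \<rho>(2)[OF slope_quotient_measurable continuous_on_slope_quotient[OF y]]
      by (simp only:) (intro tendsto_intros)
  qed
  then show ?thesis using triplet_exists[OF \<rho>(1), of G] that by blast
qed

lemma powr_weighted_limit:
  assumes p: "p = 0" and z: "0 < z"
  obtains \<rho> where "finite_on 1 \<rho>"
    "\<And>f :: real \<Rightarrow> real. f \<in> borel_measurable borel \<Longrightarrow> continuous_on {0..1} f \<Longrightarrow>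
      (\<lambda>n. s n * (\<integral>v. v powr z * f v \<partial>\<mu> n)) \<longlonglongrightarrow> (\<integral>v. f v \<partial>\<rho>)"
proof -
  have mom: "(\<lambda>n. s n * (\<integral>v. v powr z * v ^ k \<partial>\<mu> n)) \<longlonglongrightarrow> G (z + real k)" for k
  proof -
    have "v powr z * v ^ k = v powr (z + real k)" if "0 \<le> v" for v
      using that by (cases "v = 0") (auto simp: powr_add powr_realpow)
    then have "(\<integral>v. v powr z * v ^ k \<partial>\<mu> n) = (\<integral>v. v powr (z + real k) \<partial>\<mu> n)" for n
      by (intro integral_cong_unit) auto
    then show ?thesis using lim[of "z + real k"] z by (simp add: p)
  qed
  have q: "(\<lambda>v::real. v powr z) \<in> borel_measurable borel" "continuous_on {0..1} (\<lambda>v::real. v powr z)"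
    "\<And>v::real. 0 \<le> v \<Longrightarrow> v \<le> 1 \<Longrightarrow> 0 \<le> v powr z"
    using z by (auto intro!: continuous_on_powr_unit)
  show ?thesis
    using weighted_limit_measure[OF fin s_nonneg q mom] that by blast
qed

text \<open>For \<open>y < 1\<close> the function \<open>v powr (y - 1)\<close> is unbounded near \<open>0\<close>, so that \<open>G y\<close> is not immediately an
  integral with respect to the limit \<open>\<rho>\<close> of the measures with weight \<open>v\<close>. It is an integral with respect
  to the limit \<open>\<rho>'\<close> for the weight \<open>v powr (y / 2)\<close>, and \<open>v \<rho>'(dv) = v powr (y / 2) \<rho>(dv)\<close> because both
  sides are the limit for the product of the two weights. An atom of \<open>\<rho>'\<close> at \<open>0\<close> does not matter, since
  \<open>v powr (y / 2)\<close> vanishes there.\<close>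

lemma pair_limit:
  assumes p: "p = 0"
  obtains l where "is_levy_pair l" "\<And>y. 0 < y \<Longrightarrow> G y = levy_symbol l y"
proof -
  obtain \<rho> where \<rho>: "finite_on 1 \<rho>"
    "\<And>f :: real \<Rightarrow> real. f \<in> borel_measurable borel \<Longrightarrow> continuous_on {0..1} f \<Longrightarrow>
      (\<lambda>n. s n * (\<integral>v. v powr 1 * f v \<partial>\<mu> n)) \<longlonglongrightarrow> (\<integral>v. f v \<partial>\<rho>)"
    using powr_weighted_limit[OF p, of 1] by auto
  have *: "integrable \<rho> (\<lambda>v. indicator {0<..} v * v powr (y - 1)) \<and>
      G y = (\<integral>v. indicator {0<..} v * v powr (y - 1) \<partial>\<rho>)" if y: "0 < y" for y
  proof -
    define z where "z = y / 2"
    have z: "0 < z" "y = z + z" using y by (auto simp: z_def)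
    obtain \<rho>' where \<rho>': "finite_on 1 \<rho>'"
      "\<And>f :: real \<Rightarrow> real. f \<in> borel_measurable borel \<Longrightarrow> continuous_on {0..1} f \<Longrightarrow>
        (\<lambda>n. s n * (\<integral>v. v powr z * f v \<partial>\<mu> n)) \<longlonglongrightarrow> (\<integral>v. f v \<partial>\<rho>')"
      using powr_weighted_limit[OF p z(1)] by auto
    have powr_y: "v powr y = v powr z * v powr z" for v :: real
      by (simp add: z(2) flip: powr_add)
    have "(\<lambda>n. s n * (\<integral>v. v powr z * v powr z \<partial>\<mu> n)) \<longlonglongrightarrow> (\<integral>v. v powr z \<partial>\<rho>')"
      using z by (intro \<rho>' continuous_on_powr_unit) auto
    then have "(\<lambda>n. s n * ((\<integral>v. v powr y \<partial>\<mu> n) - p powr y)) \<longlonglongrightarrow> (\<integral>v. v powr z \<partial>\<rho>')"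
      using y by (simp add: p powr_y)
    then have G: "G y = (\<integral>v. v powr z \<partial>\<rho>')" using lim[OF y] LIMSEQ_unique by blast
    note w1 = finite_on_weight[OF \<rho>'(1), of "\<lambda>v. v powr 1", OF _ continuous_on_powr_unit]
    note w2 = finite_on_weight[OF \<rho>(1), of "\<lambda>v. v powr z", OF _ continuous_on_powr_unit]
    have F: "finite_on 1 (density \<rho>' (\<lambda>v. ennreal (v powr 1)))" "finite_on 1 (density \<rho> (\<lambda>v. ennreal (v powr z)))"
      by (rule w1(1); simp) (rule w2(1); use z in simp)
    have E: "density \<rho>' (\<lambda>v. ennreal (v powr 1)) = density \<rho> (\<lambda>v. ennreal (v powr z))"
    proof (rule measure_eq_if_moments_eq[OF F])
      fix k
      have "(\<lambda>n. s n * (\<integral>v. v powr z * (v powr 1 * v ^ k) \<partial>\<mu> n)) \<longlonglongrightarrow> (\<integral>v. v powr 1 * v ^ k \<partial>\<rho>')"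
        by (intro \<rho>' continuous_intros continuous_on_powr_unit) auto
      moreover have "(\<lambda>n. s n * (\<integral>v. v powr 1 * (v powr z * v ^ k) \<partial>\<mu> n)) \<longlonglongrightarrow> (\<integral>v. v powr z * v ^ k \<partial>\<rho>)"
        using z by (intro \<rho> continuous_intros continuous_on_powr_unit) auto
      ultimately have "(\<integral>v. v powr 1 * v ^ k \<partial>\<rho>') = (\<integral>v. v powr z * v ^ k \<partial>\<rho>)"
        by (intro LIMSEQ_unique) (auto simp: mult.left_commute)
      then show "(\<integral>v. v ^ k \<partial>density \<rho>' (\<lambda>v. ennreal (v powr 1))) = (\<integral>v. v ^ k \<partial>density \<rho> (\<lambda>v. ennreal (v powr z)))"
        using z by (subst w1(2); simp?) (subst w2(2); simp)
    qed
    let ?h = "\<lambda>v::real. indicator {0<..} v * v powr (z - 1)"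
    have h1: "AE v in \<rho>'. v powr z = v powr 1 * ?h v"
      using finite_onD(3)[OF \<rho>'(1)] by eventually_elim (auto simp: powr_diff split: split_indicator)
    have h2: "v powr z * ?h v = indicator {0<..} v * v powr (y - 1)" for v :: real
      by (auto simp: z(2) simp flip: powr_add split: split_indicator)
    have "integrable \<rho>' (\<lambda>v. v powr 1 * ?h v)"
    proof (rule integrable_cong_AE_imp[OF _ _ h1])
      show "integrable \<rho>' (\<lambda>v. v powr z)"
        using z by (intro finite_on_integrable[OF \<rho>'(1)] continuous_on_powr_unit) auto
    qed (simp add: measurable_cong_sets[OF finite_onD(2)[OF \<rho>'(1)] refl])
    then have "integrable (density \<rho>' (\<lambda>v. ennreal (v powr 1))) ?h"
      by (subst w1(3)) auto
    then have "integrable \<rho> (\<lambda>v. v powr z * ?h v)"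
      unfolding E using z by (subst (asm) w2(3)) auto
    moreover have "G y = (\<integral>v. v powr 1 * ?h v \<partial>\<rho>')"
      unfolding G by (rule integral_cong_AE[OF _ _ h1]) (simp_all add: measurable_cong_sets[OF finite_onD(2)[OF \<rho>'(1)] refl])
    moreover have "\<dots> = (\<integral>v. ?h v \<partial>density \<rho>' (\<lambda>v. ennreal (v powr 1)))"
      by (subst w1(2)) auto
    moreover have "\<dots> = (\<integral>v. v powr z * ?h v \<partial>\<rho>)"
      unfolding E using z by (subst w2(2)) auto
    ultimately show ?thesis by (simp add: h2)
  qed
  show ?thesis
    by (rule pair_exists[OF \<rho>(1), of G]) (use * that in auto)
qed

end

section \<open>Measurability of the Levy quadruplets\<close>

lemma levy_data_measurable:
  fixes \<rho> :: "real \<Rightarrow> real measure" and A :: "real \<Rightarrow> real"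
  defines "N \<equiv> restrict_space borel {0<..} :: real measure"
  assumes \<rho>: "\<And>x. 0 < x \<Longrightarrow> finite_on 1 (\<rho> x)"
    and cont: "\<And>f :: real \<Rightarrow> real. continuous_on UNIV f \<Longrightarrow> (\<lambda>x. \<integral>v. f v \<partial>\<rho> x) \<in> borel_measurable N"
    and A: "A \<in> borel_measurable N"
  shows "(\<lambda>x. diffusion (quadruplet_of x (\<rho> x) (A x))) \<in> borel_measurable N"
    and "(\<lambda>x. drift (quadruplet_of x (\<rho> x) (A x))) \<in> borel_measurable N"
    and "(\<lambda>x. killing (quadruplet_of x (\<rho> x) (A x))) \<in> borel_measurable N"
    and "h \<in> borel_measurable borel \<Longrightarrow>
      (\<lambda>x. \<integral>u. h u \<partial>jumps (quadruplet_of x (\<rho> x) (A x)) :: real) \<in> borel_measurable N"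
proof -
  have space_N: "x \<in> space N \<longleftrightarrow> 0 < x" for x by (simp add: N_def space_restrict_space)
  have id [measurable]: "(\<lambda>x. x) \<in> measurable N borel"
    unfolding N_def by (rule measurable_restrict_space1) simp
  have kernel: "(\<lambda>x. \<integral>v. F x v \<partial>\<rho> x) \<in> borel_measurable N"
    if "(\<lambda>(x, v). F x v) \<in> borel_measurable (N \<Otimes>\<^sub>M borel)" for F :: "real \<Rightarrow> real \<Rightarrow> real"
    by (rule borel_measurable_integral_finite_kernel[OF _ _ cont that])
      (simp_all add: space_N finite_onD[OF \<rho>])
  have atom: "(\<lambda>x. measure (\<rho> x) {g x}) \<in> borel_measurable N"
    if [measurable]: "g \<in> borel_measurable N" for g
  proof -
    have "(\<lambda>x. \<integral>v. (if v = g x then (1::real) else 0) \<partial>\<rho> x) \<in> borel_measurable N"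
      by (rule kernel) measurable
    then show ?thesis
    proof (rule measurable_cong[THEN iffD1, rotated])
      fix x assume "x \<in> space N"
      then have "finite_on 1 (\<rho> x)" using \<rho> by (simp add: space_N)
      have "(\<integral>v. (if v = g x then (1::real) else 0) \<partial>\<rho> x) = (\<integral>v. indicat_real {g x} v \<partial>\<rho> x)"
        by (rule Bochner_Integration.integral_cong) (auto split: split_indicator)
      then show "(\<integral>v. (if v = g x then (1::real) else 0) \<partial>\<rho> x) = measure (\<rho> x) {g x}"
        using finite_onD(4)[OF \<open>finite_on 1 (\<rho> x)\<close>] by simp
    qed
  qed
  define \<nu> where "\<nu> x = jump_measure {- x..} x (\<lambda>v. (v - exp (- x))\<^sup>2) (\<rho> x)" for x
  define a where "a x = measure (\<rho> x) {exp (- x)} / (2 * (exp (- x))\<^sup>2)" for x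
  define c where "c x = measure (\<rho> x) {0} / (exp (- x))\<^sup>2" for x
  have Q: "quadruplet_of x (\<rho> x) (A x) =
      Levy_Quadruplet (\<nu> x) (a x) ((\<integral>u. levy_kernel 1 u \<partial>\<nu> x) - exp x * A x - c x + a x) (c x)" for x
    by (simp add: quadruplet_of_def Let_def \<nu>_def a_def c_def)
  have [measurable]: "(\<lambda>x. measure (\<rho> x) {exp (- x)}) \<in> borel_measurable N" "(\<lambda>x. measure (\<rho> x) {0}) \<in> borel_measurable N"
    by (intro atom; measurable)+
  have a: "a \<in> borel_measurable N" unfolding a_def[abs_def] by measurable
  have c: "c \<in> borel_measurable N" unfolding c_def[abs_def] by measurable
  have jumps: "(\<lambda>x. \<integral>u. h u \<partial>\<nu> x) \<in> borel_measurable N"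
    if [measurable]: "h \<in> borel_measurable borel" for h :: "real \<Rightarrow> real"
  proof -
    \<comment> \<open>The condition \<open>- x \<le> - ln v - x\<close> is written as \<open>ln v \<le> 0\<close>, free of \<open>x\<close>.\<close>
    let ?F = "\<lambda>x v. (if 0 < v then 1 else 0) / (v - exp (- x))\<^sup>2 * ((if ln v \<le> 0 then 1 else 0) * h (- ln v - x))"
    have "(\<lambda>x. \<integral>v. ?F x v \<partial>\<rho> x) \<in> borel_measurable N"
      by (rule kernel) measurable
    then show ?thesis
    proof (rule measurable_cong[THEN iffD1, rotated])
      fix x assume "x \<in> space N"
      then have \<rho>x: "finite_on 1 (\<rho> x)" using \<rho> by (simp add: space_N)
      have "(\<integral>u. h u \<partial>\<nu> x) = (\<integral>v. (indicator {0<..} v / (v - exp (- x))\<^sup>2) *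
          (indicator {- x..} (- ln v - x) * h (- ln v - x)) \<partial>\<rho> x)"
        unfolding \<nu>_def using finite_onD(2)[OF \<rho>x] by (intro integral_jump_measure) auto
      also have "\<dots> = (\<integral>v. ?F x v \<partial>\<rho> x)"
        by (rule Bochner_Integration.integral_cong) (auto split: split_indicator)
      finally show "(\<integral>v. ?F x v \<partial>\<rho> x) = (\<integral>u. h u \<partial>\<nu> x)" by simp
    qed
  qed
  show "(\<lambda>x. diffusion (quadruplet_of x (\<rho> x) (A x))) \<in> borel_measurable N" using a by (simp add: Q)
  show "(\<lambda>x. killing (quadruplet_of x (\<rho> x) (A x))) \<in> borel_measurable N" using c by (simp add: Q)
  show "h \<in> borel_measurable borel \<Longrightarrow> (\<lambda>x. \<integral>u. h u \<partial>jumps (quadruplet_of x (\<rho> x) (A x))) \<in> borel_measurable N"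
    using jumps by (simp add: Q)
  have "(\<lambda>x. (\<integral>u. levy_kernel 1 u \<partial>\<nu> x) - exp x * A x - c x + a x) \<in> borel_measurable N"
    using jumps[OF levy_kernel_measurable] a c A by measurable
  then show "(\<lambda>x. drift (quadruplet_of x (\<rho> x) (A x))) \<in> borel_measurable N" by (simp add: Q)
qed

section \<open>The generator on exponential functions\<close>

lemma exp_fun_measurable [measurable]: "exp_fun y \<in> borel_measurable borel"
  unfolding exp_fun_def[abs_def] by measurable

lemma exp_fun_unit: "0 \<le> exp_fun 1 u" "exp_fun 1 u \<le> 1"
  by (auto simp: exp_fun_def)

lemma exp_fun_powr: "0 < y \<Longrightarrow> exp_fun 1 u powr y = exp_fun y u"
  by (simp add: exp_fun_def powr_def mult.commute)

context positive_markov_process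
begin

text \<open>The law of \<open>exp (- X t)\<close> under \<open>P x\<close>, with \<open>exp (- \<infinity>) = 0\<close>.\<close>

definition exp_law :: "real \<Rightarrow> ennreal \<Rightarrow> real measure" where
  "exp_law t x = distr (P x) borel (\<lambda>\<omega>. exp_fun 1 (X t \<omega>))"

lemma X_measurable: "0 \<le> t \<Longrightarrow> X t \<in> measurable (P x) borel"
  using measurable_X[of t] by (simp add: measurable_cong_sets[OF sets_P refl])

lemma exp_law_finite_on:
  assumes t: "0 \<le> t"
  shows "finite_on 1 (exp_law t x)" and "measure (exp_law t x) UNIV = 1"
proof -
  interpret prob_space "P x" by (rule prob_space_P)
  have m [measurable]: "(\<lambda>\<omega>. exp_fun 1 (X t \<omega>)) \<in> measurable (P x) borel"
    using X_measurable[OF t] by measurable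
  interpret E: prob_space "exp_law t x"
    unfolding exp_law_def by (rule prob_space_distr[OF m])
  have "AE v in exp_law t x. v \<in> {0..1}"
    unfolding exp_law_def by (subst AE_distr_iff[OF m]) (auto simp: exp_fun_unit)
  moreover have "finite_measure (exp_law t x)" by (rule E.finite_measure_axioms)
  moreover have "sets (exp_law t x) = sets borel" by (simp add: exp_law_def)
  ultimately show "finite_on 1 (exp_law t x)" by (simp add: finite_on_def)
  show "measure (exp_law t x) UNIV = 1"
    using E.prob_space by (simp add: exp_law_def)
qed

lemma exp_law_powr:
  assumes t: "0 \<le> t" and y: "0 < y"
  shows "(\<integral>v. v powr y \<partial>exp_law t x) = transition_op P X t (exp_fun y) x"
  unfolding exp_law_def transition_op_def using X_measurable[OF t]
  by (subst integral_distr) (auto simp: exp_fun_powr[OF y])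

lemma exp_law_measurable:
  assumes t: "0 \<le> t" and f: "f \<in> borel_measurable borel"
  shows "(\<lambda>x. \<integral>v. f v \<partial>exp_law t x :: real) \<in> borel_measurable borel"
proof -
  have "exp_law t \<in> measurable borel (subprob_algebra borel)"
  proof (rule measurable_subprob_algebra)
    fix x
    interpret prob_space "P x" by (rule prob_space_P)
    have m [measurable]: "(\<lambda>\<omega>. exp_fun 1 (X t \<omega>)) \<in> measurable (P x) borel"
      using X_measurable[OF t] by measurable
    interpret E: prob_space "exp_law t x"
      unfolding exp_law_def by (rule prob_space_distr[OF m])
    show "subprob_space (exp_law t x)" by (rule E.subprob_space_axioms)
    show "sets (exp_law t x) = sets borel" by (simp add: exp_law_def)
  next
    fix B :: "real set" assume B: "B \<in> sets borel"
    have "(\<lambda>x. ennreal (measure (P x) {\<omega> \<in> space M. X t \<omega> \<in> exp_fun 1 -` B})) \<in> borel_measurable borel"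
      using measurable_sets[OF exp_fun_measurable B, of 1] by (intro measurable_compose[OF measurable_kernel[OF t]]) auto
    also have "(\<lambda>x. ennreal (measure (P x) {\<omega> \<in> space M. X t \<omega> \<in> exp_fun 1 -` B})) = (\<lambda>x. emeasure (exp_law t x) B)"
    proof
      fix x
      interpret prob_space "P x" by (rule prob_space_P)
      have m: "(\<lambda>\<omega>. exp_fun 1 (X t \<omega>)) \<in> measurable (P x) borel"
        using X_measurable[OF t] by measurable
      have "emeasure (exp_law t x) B = emeasure (P x) ((\<lambda>\<omega>. exp_fun 1 (X t \<omega>)) -` B \<inter> space (P x))"
        unfolding exp_law_def using m B by (rule emeasure_distr)
      also have "(\<lambda>\<omega>. exp_fun 1 (X t \<omega>)) -` B \<inter> space (P x) = {\<omega> \<in> space M. X t \<omega> \<in> exp_fun 1 -` B}"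
        using sets_eq_imp_space_eq[OF sets_P[of x]] by auto
      finally show "ennreal (measure (P x) {\<omega> \<in> space M. X t \<omega> \<in> exp_fun 1 -` B}) = emeasure (exp_law t x) B"
        by (simp add: emeasure_eq_measure)
    qed
    finally show "(\<lambda>x. emeasure (exp_law t x) B) \<in> borel_measurable borel" .
  qed
  then show ?thesis
    by (rule measurable_compose[OF _ integral_measurable_subprob_algebra[OF f]])
qed

text \<open>A sequence of times along which the limit that defines the generator is taken.\<close>

definition mesh :: "nat \<Rightarrow> real" where "mesh n = inverse (real (Suc n))"

lemma mesh_pos: "0 < mesh n" by (simp add: mesh_def)

lemma mesh_tendsto: "filterlim mesh (at_right 0) sequentially"
  unfolding filterlim_at mesh_def[abs_def] using LIMSEQ_inverse_real_of_nat by simp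

end

text \<open>A positive Markov process whose generator is defined on \<open>exp_fun y\<close> for all \<open>y > 0\<close>.\<close>

locale exponential_generator = positive_markov_process +
  assumes exp_fun_dom: "\<And>y. 0 < y \<Longrightarrow> exp_fun y \<in> generator_dom P X"
begin

abbreviation G :: "ennreal \<Rightarrow> real \<Rightarrow> real" where "G x y \<equiv> generator P X (exp_fun y) x"

lemma generator_limit:
  assumes y: "0 < y"
  shows "(\<lambda>n. inverse (mesh n) * ((\<integral>v. v powr y \<partial>exp_law (mesh n) x) - exp_fun 1 x powr y)) \<longlonglongrightarrow> G x y"
proof -
  obtain L where L: "((\<lambda>t. (transition_op P X t (exp_fun y) x - exp_fun y x) / t) \<longlongrightarrow> L) (at_right 0)"
    using exp_fun_dom[OF y] by (auto simp: generator_dom_def)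
  then have "G x y = L" unfolding generator_def by (intro tendsto_Lim) auto
  moreover have "(\<lambda>n. (transition_op P X (mesh n) (exp_fun y) x - exp_fun y x) / mesh n) \<longlonglongrightarrow> L"
    by (rule filterlim_compose[OF L mesh_tendsto])
  ultimately show ?thesis
    using y mesh_pos by (simp add: exp_law_powr exp_fun_powr less_imp_le divide_inverse mult.commute)
qed

lemma exponential_limits_at:
  "exponential_limits (\<lambda>n. exp_law (mesh n) x) (\<lambda>n. inverse (mesh n)) (exp_fun 1 x) (G x)"
  using mesh_pos by (unfold_locales) (auto intro!: exp_law_finite_on generator_limit exp_fun_unit simp: less_imp_le)

lemma levy_family_exists:
  "\<exists>l. levy_family l \<and> (\<forall>x. \<forall>y>0. G x y =
     (if x = \<infinity> then family_symbol l x y else family_symbol l x y * exp (- (enn2real x * y))))"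
proof -
  let ?s = "\<lambda>n. inverse (mesh n)" and ?\<mu> = "\<lambda>n x. exp_law (mesh n) x"
  have p: "exp_fun 1 (ennreal x) = exp (- x)" if "0 < x" for x
    using that by (simp add: exp_fun_def)
  \<comment> \<open>\<open>R x \<rho>\<close> says that \<open>\<rho>\<close> is the limit measure at the state \<open>x\<close>.\<close>
  define R where "R x \<rho> \<longleftrightarrow> finite_on 1 \<rho> \<and>
    (\<forall>f :: real \<Rightarrow> real. f \<in> borel_measurable borel \<longrightarrow> continuous_on {0..1} f \<longrightarrow>
      (\<lambda>n. ?s n * (\<integral>v. (v - exp (- x))\<^sup>2 * f v \<partial>?\<mu> n (ennreal x))) \<longlonglongrightarrow> (\<integral>v. f v \<partial>\<rho>)) \<and>
    (\<forall>y>0. G (ennreal x) y = y * exp (- x) powr (y - 1) * G (ennreal x) 1 + (\<integral>v. taylor_quotient (exp (- x)) y v \<partial>\<rho>))"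
    for x :: real and \<rho> :: "real measure"
  have "\<exists>\<rho>. R x \<rho>" if x: "0 < x" for x
  proof -
    interpret exponential_limits "\<lambda>n. exp_law (mesh n) (ennreal x)" ?s "exp (- x)" "G (ennreal x)"
      using exponential_limits_at[of "ennreal x"] unfolding p[OF x] .
    show ?thesis
    proof (rule second_order_limit[OF exp_gt_zero], rule exI)
      show "R x \<rho>" if "finite_on 1 \<rho>"
        "\<And>f :: real \<Rightarrow> real. f \<in> borel_measurable borel \<Longrightarrow> continuous_on {0..1} f \<Longrightarrow>
          (\<lambda>n. ?s n * (\<integral>v. (v - exp (- x))\<^sup>2 * f v \<partial>?\<mu> n (ennreal x))) \<longlonglongrightarrow> (\<integral>v. f v \<partial>\<rho>)"
        "\<And>y. 0 < y \<Longrightarrow> G (ennreal x) y = y * exp (- x) powr (y - 1) * G (ennreal x) 1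
          + (\<integral>v. taylor_quotient (exp (- x)) y v \<partial>\<rho>)" for \<rho>
        unfolding R_def by (intro conjI allI impI that)
    qed
  qed
  then obtain \<rho> where R: "\<And>x. 0 < x \<Longrightarrow> R x (\<rho> x)" by metis
  have \<rho>: "finite_on 1 (\<rho> x)" if "0 < x" for x
    using R[OF that] unfolding R_def by (rule conjunct1)
  have \<rho>_lim: "(\<lambda>n. ?s n * (\<integral>v. (v - exp (- x))\<^sup>2 * f v \<partial>?\<mu> n (ennreal x))) \<longlonglongrightarrow> (\<integral>v. f v \<partial>\<rho> x)"
    if "0 < x" "f \<in> borel_measurable borel" "continuous_on {0..1} f" for x and f :: "real \<Rightarrow> real"
    using R[OF that(1), unfolded R_def, THEN conjunct2, THEN conjunct1, rule_format, OF that(2,3)] .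
  have \<rho>_eq: "G (ennreal x) y = y * exp (- x) powr (y - 1) * G (ennreal x) 1 + (\<integral>v. taylor_quotient (exp (- x)) y v \<partial>\<rho> x)"
    if "0 < x" "0 < y" for x y
    using R[OF that(1), unfolded R_def, THEN conjunct2, THEN conjunct2, rule_format, OF that(2)] .
  obtain l0 where l0: "is_levy_triplet l0" "\<And>y. 0 < y \<Longrightarrow> G 0 y = levy_symbol l0 y"
  proof -
    interpret exponential_limits "\<lambda>n. exp_law (mesh n) 0" ?s "exp_fun 1 0" "G 0"
      by (rule exponential_limits_at)
    show ?thesis using triplet_limit that by (simp add: exp_fun_def) blast
  qed
  obtain li where li: "is_levy_pair li" "\<And>y. 0 < y \<Longrightarrow> G \<infinity> y = levy_symbol li y"
  proof -
    interpret exponential_limits "\<lambda>n. exp_law (mesh n) \<infinity>" ?s "exp_fun 1 \<infinity>" "G \<infinity>"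
      by (rule exponential_limits_at)
    show ?thesis using pair_limit that by (simp add: exp_fun_def) blast
  qed
  define N :: "real measure" where "N = restrict_space borel {0<..}"
  have space_N: "x \<in> space N \<longleftrightarrow> 0 < x" for x by (simp add: N_def space_restrict_space)
  have id [measurable]: "(\<lambda>x. x) \<in> measurable N borel"
    unfolding N_def by (rule measurable_restrict_space1) simp
  have \<mu>_kernel: "(\<lambda>x. \<integral>v. F x v \<partial>?\<mu> n (ennreal x)) \<in> borel_measurable N"
    if "(\<lambda>(x, v). F x v) \<in> borel_measurable (N \<Otimes>\<^sub>M borel)" for F :: "real \<Rightarrow> real \<Rightarrow> real" and n
  proof (rule borel_measurable_integral_finite_kernel[OF _ _ _ that])
    fix f :: "real \<Rightarrow> real" assume "continuous_on UNIV f"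
    then have "f \<in> borel_measurable borel" by (rule borel_measurable_continuous_onI)
    then show "(\<lambda>x. \<integral>v. f v \<partial>?\<mu> n (ennreal x)) \<in> borel_measurable N"
      using mesh_pos[of n] by (intro measurable_compose[OF _ exp_law_measurable]) auto
  qed (rule finite_onD[OF exp_law_finite_on(1)[OF less_imp_le[OF mesh_pos]]])+
  \<comment> \<open>The measures \<open>\<rho> x\<close> were chosen one by one; measurability in \<open>x\<close> holds because integrals of
    continuous functions are limits of measurable functions of \<open>x\<close>.\<close>
  have \<rho>_meas: "(\<lambda>x. \<integral>v. f v \<partial>\<rho> x) \<in> borel_measurable N" if f: "continuous_on UNIV f" for f :: "real \<Rightarrow> real"
  proof (rule borel_measurable_LIMSEQ_real)
    have [measurable]: "f \<in> borel_measurable borel" using f by (rule borel_measurable_continuous_onI)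
    fix n
    have "(\<lambda>x. \<integral>v. (v - exp (- x))\<^sup>2 * f v \<partial>?\<mu> n (ennreal x)) \<in> borel_measurable N"
      by (rule \<mu>_kernel) measurable
    then show "(\<lambda>x. ?s n * (\<integral>v. (v - exp (- x))\<^sup>2 * f v \<partial>?\<mu> n (ennreal x))) \<in> borel_measurable N"
      by measurable
  next
    fix x assume "x \<in> space N"
    then show "(\<lambda>n. ?s n * (\<integral>v. (v - exp (- x))\<^sup>2 * f v \<partial>?\<mu> n (ennreal x))) \<longlonglongrightarrow> (\<integral>v. f v \<partial>\<rho> x)"
      using f by (intro \<rho>_lim) (auto simp: space_N intro: borel_measurable_continuous_onI continuous_on_subset)
  qed
  have G_meas: "(\<lambda>x. G (ennreal x) 1) \<in> borel_measurable N"
  proof (rule borel_measurable_LIMSEQ_real)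
    fix n
    have "(\<lambda>x. \<integral>v. v powr 1 \<partial>?\<mu> n (ennreal x)) \<in> borel_measurable N"
      by (rule \<mu>_kernel) measurable
    then show "(\<lambda>x. ?s n * ((\<integral>v. v powr 1 \<partial>?\<mu> n (ennreal x)) - exp_fun 1 (ennreal x) powr 1)) \<in> borel_measurable N"
      by measurable
  qed (rule generator_limit, simp)
  define lq where "lq x = quadruplet_of x (\<rho> x) (G (ennreal x) 1)" for x
  define l where "l x = (if x = \<infinity> then li else if x = 0 then l0 else lq (enn2real x))" for x
  have l_pos: "l (ennreal x) = lq x" if "0 < x" for x
    using that by (simp add: l_def)
  have lq: "is_levy_quadruplet x (lq x)" if x: "0 < x" for x
    unfolding lq_def
    by (rule quadruplet_of_correct(1)[where L="G (ennreal x)", OF x \<rho>[OF x] \<rho>_eq[OF x]])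
  have lq_symbol: "G (ennreal x) y = levy_symbol (lq x) y * exp (- (x * y))" if x: "0 < x" and y: "0 < y" for x y
    unfolding lq_def
    by (rule quadruplet_of_correct(2)[where L="G (ennreal x)", OF x \<rho>[OF x] \<rho>_eq[OF x] y])
  note meas = levy_data_measurable[of \<rho> "\<lambda>x. G (ennreal x) 1", folded N_def, OF \<rho> \<rho>_meas G_meas, folded lq_def]
  have transfer: "(\<lambda>x. F x (l (ennreal x))) \<in> borel_measurable (restrict_space borel {0<..})"
    if "(\<lambda>x. F x (lq x)) \<in> borel_measurable N" for F :: "real \<Rightarrow> levy_data \<Rightarrow> real"
    using that unfolding N_def[symmetric]
    by (rule measurable_cong[THEN iffD1, rotated]) (simp add: l_pos space_N)
  have "levy_family l"
    unfolding levy_family_def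
  proof (intro conjI allI impI)
    show "is_levy_quadruplet x (l (ennreal x))" if "0 < x" for x using lq[OF that] by (simp add: l_pos[OF that])
    show "is_levy_triplet (l 0)" "is_levy_pair (l \<infinity>)" using l0 li by (simp_all add: l_def)
    show "(\<lambda>x. \<integral>u. g u * min 1 (u\<^sup>2) \<partial>jumps (l (ennreal x))) \<in> borel_measurable (restrict_space borel {0<..})"
      if [measurable]: "g \<in> borel_measurable borel" for g :: "real \<Rightarrow> real"
      by (rule transfer[of "\<lambda>x d. \<integral>u. g u * min 1 (u\<^sup>2) \<partial>jumps d"], rule meas) measurable
    show "(\<lambda>x. diffusion (l (ennreal x))) \<in> borel_measurable (restrict_space borel {0<..})"
      by (rule transfer[of "\<lambda>_. diffusion"], rule meas(1))
    show "(\<lambda>x. drift (l (ennreal x))) \<in> borel_measurable (restrict_space borel {0<..})"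
      by (rule transfer[of "\<lambda>_. drift"], rule meas(2))
    show "(\<lambda>x. killing (l (ennreal x))) \<in> borel_measurable (restrict_space borel {0<..})"
      by (rule transfer[of "\<lambda>_. killing"], rule meas(3))
  qed
  moreover have "G x y = (if x = \<infinity> then family_symbol l x y else family_symbol l x y * exp (- (enn2real x * y)))"
    if y: "0 < y" for x y
  proof -
    consider "x = \<infinity>" | "x = 0" | r where "x = ennreal r" "0 < r"
      by (cases x) (auto simp: less_le)
    then show ?thesis
    proof cases
      case 3
      then show ?thesis using lq_symbol[OF \<open>0 < r\<close> y] by (simp add: family_symbol_def l_pos)
    qed (use y l0 li in \<open>simp_all add: family_symbol_def l_def\<close>)
  qed
  ultimately show ?thesis by blast
qed

end

section \<open>Uniqueness\<close>

text \<open>In the variable \<open>y\<close>, all parts of a symbol except the jump exponentials are polynomials of degree at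
  most two and vanish under differences of order three. The order four is used because its kernel
  \<open>(1 - exp (- u)) ^ 4\<close> is nonnegative.\<close>

lemma fourth_difference:
  fixes K :: "real \<Rightarrow> real"
  assumes K: "\<And>y. 0 < y \<Longrightarrow> K y = exp (- (u * y)) - \<alpha> - y * \<beta>" and y: "0 < y"
  shows "K y - 4 * K (y + 1) + 6 * K (y + 2) - 4 * K (y + 3) + K (y + 4) = exp (- (u * y)) * (1 - exp (- u)) ^ 4"
proof -
  have e: "exp (- (u * (y + j))) = exp (- (u * y)) * exp (- (u * j))" for j
    by (simp add: algebra_simps flip: exp_add)
  have e': "exp (- (u * real j)) = exp (- u) ^ j" for j
    by (simp add: exp_of_nat_mult[symmetric] mult.commute)
  show ?thesis
    using y e[of 1] e[of 2] e[of 3] e[of 4] e'[of 1] e'[of 2] e'[of 3] e'[of 4]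
    by (simp add: K power4_eq_xxxx power3_eq_cube power2_eq_square algebra_simps)
qed

text \<open>The three kinds of symbols are treated at once: \<open>\<alpha>\<close> and \<open>\<beta>\<close> describe the compensator in the
  integrand \<open>K\<close>, and \<open>A\<close>, \<open>B\<close>, \<open>C\<close> the difference of the remaining parameters. The two measures are indexed
  by \<^typ>\<open>bool\<close>. The fourth differences at \<open>y = k + 1\<close> are the moments, in \<open>v = exp (- u)\<close>, of a
  measure on the bounded interval \<open>{0..exp x}\<close>, so that they determine it.\<close>

lemma jump_measure_unique:
  fixes K :: "real \<Rightarrow> real \<Rightarrow> real"
  assumes S: "S \<in> sets borel" "S \<subseteq> {- x..}"
    and sets: "\<And>i. sets (\<nu> i) = sets (restrict_space borel S)"
    and null: "\<And>i. emeasure (\<nu> i) ({0} \<inter> S) = 0"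
    and int: "\<And>i y. 0 < y \<Longrightarrow> integrable (\<nu> i) (K y)"
    and K: "\<And>y u. 0 < y \<Longrightarrow> u \<in> S \<Longrightarrow> K y u = exp (- (u * y)) - \<alpha> - y * \<beta> u"
    and diff: "\<And>y. 0 < y \<Longrightarrow> (\<integral>u. K y u \<partial>\<nu> True) - (\<integral>u. K y u \<partial>\<nu> False) = A * y\<^sup>2 + B * y + C"
  shows "\<nu> True = \<nu> False"
proof -
  \<comment> \<open>The factor \<open>exp (- u)\<close> shifts the moments to exponents \<open>y \<ge> 1\<close>, since symbols are given for \<open>y > 0\<close>.\<close>
  define W where "W u = exp (- u) * (1 - exp (- u)) ^ 4" for u :: real
  have W: "0 \<le> W u" "W u = 0 \<longleftrightarrow> u = 0" for u by (auto simp: W_def)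
  have W_meas: "W \<in> borel_measurable borel" unfolding W_def[abs_def] by measurable
  have space: "space (\<nu> i) = S" for i
    using sets_eq_imp_space_eq[OF sets[of i]] by (simp add: space_restrict_space)
  have meas: "f \<in> measurable (\<nu> i) N" if "f \<in> measurable borel N" for f :: "real \<Rightarrow> 'b" and N i
    unfolding measurable_cong_sets[OF sets refl] using that by (rule measurable_restrict_space1)
  let ?D = "\<lambda>y u. K y u - 4 * K (y + 1) u + 6 * K (y + 2) u - 4 * K (y + 3) u + K (y + 4) u"
  have D: "?D y u = exp (- (u * y)) * (1 - exp (- u)) ^ 4" if "0 < y" "u \<in> S" for y u
    using K that by (intro fourth_difference[of "\<lambda>y. K y u" u \<alpha> "\<beta> u"]) auto
  have Dint: "integrable (\<nu> i) (?D y)" if "0 < y" for i y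
    using that by (intro Bochner_Integration.integrable_add Bochner_Integration.integrable_diff
        integrable_mult_right int) auto
  have D_eq: "(\<integral>u. ?D y u \<partial>\<nu> True) = (\<integral>u. ?D y u \<partial>\<nu> False)" if y: "0 < y" for y
  proof -
    have I: "(\<integral>u. ?D y u \<partial>\<nu> i) = (\<integral>u. K y u \<partial>\<nu> i) - 4 * (\<integral>u. K (y + 1) u \<partial>\<nu> i)
        + 6 * (\<integral>u. K (y + 2) u \<partial>\<nu> i) - 4 * (\<integral>u. K (y + 3) u \<partial>\<nu> i) + (\<integral>u. K (y + 4) u \<partial>\<nu> i)" for i
      using y by (simp add: int)
    show ?thesis
      unfolding I using diff[of y] diff[of "y + 1"] diff[of "y + 2"] diff[of "y + 3"] diff[of "y + 4"] y
      by (simp add: algebra_simps power2_eq_square)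
  qed
  have WD: "W u * exp (- u) ^ k = ?D (real (Suc k)) u" if "u \<in> S" for u k
  proof -
    have "exp (- u) * exp (- u) ^ k = exp (- (u * real (Suc k)))"
      by (simp add: exp_of_nat_mult[symmetric] algebra_simps flip: exp_add)
    then show ?thesis using D[of "real (Suc k)" u] that by (simp add: W_def mult.assoc mult.left_commute)
  qed
  define \<rho> where "\<rho> i = distr (density (\<nu> i) (\<lambda>u. ennreal (W u))) borel (\<lambda>u. exp (- u))" for i
  have fin: "finite_on (exp x) (\<rho> i)" for i
  proof -
    have "integrable (\<nu> i) W"
      using Dint[of 1 i] by (rule Bochner_Integration.integrable_cong[THEN iffD1, rotated -1])
        (use WD[of _ 0] in \<open>auto simp: space\<close>)
    then have "(\<integral>\<^sup>+u. ennreal (W u) \<partial>\<nu> i) < \<infinity>"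
      by (subst nn_integral_eq_integral) (auto simp: W)
    moreover have "emeasure (\<rho> i) UNIV = (\<integral>\<^sup>+u. ennreal (W u) \<partial>\<nu> i)"
    proof -
      have "S \<in> sets (\<nu> i)" using sets.top[of "\<nu> i"] by (simp add: space)
      then have "emeasure (density (\<nu> i) (\<lambda>u. ennreal (W u))) S = (\<integral>\<^sup>+u. ennreal (W u) * indicator S u \<partial>\<nu> i)"
        by (intro emeasure_density) (auto intro!: meas W_meas measurable_compose[OF W_meas])
      also have "\<dots> = (\<integral>\<^sup>+u. ennreal (W u) \<partial>\<nu> i)"
        by (rule nn_integral_cong) (simp add: space)
      finally show ?thesis
        unfolding \<rho>_def by (subst emeasure_distr) (auto simp: space intro!: meas)
    qed
    ultimately have "finite_measure (\<rho> i)"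
      by (intro finite_measureI) (simp add: \<rho>_def)
    moreover have "AE v in \<rho> i. v \<in> {0..exp x}"
      unfolding \<rho>_def
      by (subst AE_distr_iff) (use S in \<open>auto simp: meas W_meas AE_density space intro!: AE_I2\<close>)
    moreover have "sets (\<rho> i) = sets borel" by (simp add: \<rho>_def)
    ultimately show ?thesis by (simp add: finite_on_def)
  qed
  have mom: "(\<integral>v. v ^ k \<partial>\<rho> i) = (\<integral>u. ?D (real (Suc k)) u \<partial>\<nu> i)" for k i
  proof -
    have "(\<integral>v. v ^ k \<partial>\<rho> i) = (\<integral>u. exp (- u) ^ k \<partial>density (\<nu> i) (\<lambda>u. ennreal (W u)))"
      unfolding \<rho>_def by (subst integral_distr) (auto intro!: meas)
    also have "\<dots> = (\<integral>u. W u * exp (- u) ^ k \<partial>\<nu> i)"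
      by (subst integral_density) (auto intro!: meas W_meas simp: W)
    also have "\<dots> = (\<integral>u. ?D (real (Suc k)) u \<partial>\<nu> i)"
      by (rule Bochner_Integration.integral_cong[OF refl WD]) (simp add: space)
    finally show ?thesis .
  qed
  have \<rho>_eq: "\<rho> True = \<rho> False"
  proof (rule measure_eq_if_moments_eq[OF fin fin])
    show "(\<integral>v. v ^ k \<partial>\<rho> True) = (\<integral>v. v ^ k \<partial>\<rho> False)" for k
      unfolding mom by (rule D_eq) simp
  qed
  \<comment> \<open>The jump measure is recovered by undoing the image and dividing by the weight, which vanishes
    at \<open>0\<close> only.\<close>
  have recover: "emeasure (\<nu> i) Z = (\<integral>\<^sup>+v. ennreal (1 / W (- ln v)) * indicator (Z - {0}) (- ln v) \<partial>\<rho> i)"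
    if Z: "Z \<in> sets (restrict_space borel S)" for i Z
  proof -
    have ZB: "Z \<in> sets borel" "Z \<subseteq> S" using Z S by (auto simp: sets_restrict_space_iff)
    have Z0: "Z - {0} \<in> sets (\<nu> i)" "{0} \<inter> S \<in> sets (\<nu> i)"
      using ZB S by (auto simp: sets sets_restrict_space_iff)
    have [measurable]: "Z - {0} \<in> sets borel" using ZB by simp
    note W_meas[measurable]
    have "emeasure (\<nu> i) Z = emeasure (\<nu> i) (Z - {0})"
    proof (rule emeasure_eq_AE)
      show "AE u in \<nu> i. u \<in> Z \<longleftrightarrow> u \<in> Z - {0}"
        by (rule AE_I[OF _ null[of i] Z0(2)]) (auto simp: space)
    qed (use Z Z0 in \<open>auto simp: sets\<close>)
    also have "\<dots> = (\<integral>\<^sup>+u. indicator (Z - {0}) u \<partial>\<nu> i)"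
      using Z0 by simp
    also have "\<dots> = (\<integral>\<^sup>+u. ennreal (W u) * (ennreal (1 / W (- ln (exp (- u)))) * indicator (Z - {0}) (- ln (exp (- u)))) \<partial>\<nu> i)"
      using W by (intro nn_integral_cong) (auto simp: less_le simp flip: ennreal_mult' split: split_indicator)
    also have "\<dots> = (\<integral>\<^sup>+u. ennreal (1 / W (- ln (exp (- u)))) * indicator (Z - {0}) (- ln (exp (- u)))
        \<partial>density (\<nu> i) (\<lambda>u. ennreal (W u)))"
      by (subst nn_integral_density) (auto intro!: meas)
    also have "\<dots> = (\<integral>\<^sup>+v. ennreal (1 / W (- ln v)) * indicator (Z - {0}) (- ln v) \<partial>\<rho> i)"
      unfolding \<rho>_def by (subst nn_integral_distr) (auto intro!: meas)
    finally show ?thesis .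
  qed
  show ?thesis
    by (rule measure_eqI) (auto simp: sets recover \<rho>_eq)
qed

lemma quadratic_zero:
  fixes a b c :: real
  assumes "\<And>y. 0 < y \<Longrightarrow> a * y\<^sup>2 + b * y + c = 0"
  shows "a = 0" "b = 0" "c = 0"
  using assms[of 1] assms[of 2] assms[of 3] by auto

lemma quadruplet_unique:
  assumes l: "is_levy_quadruplet x l" "is_levy_quadruplet x l'"
    and eq: "\<And>y. 0 < y \<Longrightarrow> levy_symbol l y = levy_symbol l' y"
  shows "l = l'"
proof -
  obtain \<nu> a b c \<nu>' a' b' c' where L: "l = Levy_Quadruplet \<nu> a b c" "l' = Levy_Quadruplet \<nu>' a' b' c'"
    using l by (cases l; cases l') auto
  note S = l[unfolded L is_levy_quadruplet.simps]
  have int: "integrable N (levy_kernel y)"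
    if "0 < y" "sets N = sets (restrict_space borel {- x..})" "(\<integral>\<^sup>+u. ennreal (min 1 (u\<^sup>2)) \<partial>N) < \<infinity>" for N y
    using abs_levy_kernel_le[OF that(1), of x] by (intro integrable_if_dominated[OF that(2,3)]) auto
  have null: "emeasure N ({0} \<inter> {- x..}) = 0" if "emeasure N {0} = 0" for N :: "real measure"
    using that by (cases "0 \<le> x") auto
  have symb: "(\<integral>u. levy_kernel y u \<partial>\<nu>) - (\<integral>u. levy_kernel y u \<partial>\<nu>') = (a' - a) * y\<^sup>2 + (b - b') * y + (c - c')"
    if "0 < y" for y
    using eq[OF that] unfolding L levy_symbol_quadruplet by (simp add: algebra_simps)
  have "(if True then \<nu> else \<nu>') = (if False then \<nu> else \<nu>')"
    by (rule jump_measure_unique[where S="{- x..}" and K=levy_kernel and \<alpha>=1 and x=x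
        and \<beta>="\<lambda>u. - u * indicator {-1..1} u" and A="a' - a" and B="b - b'" and C="c - c'" and \<nu>="\<lambda>i. if i then \<nu> else \<nu>'"])
      (use S symb in \<open>auto simp: int null levy_kernel_def\<close>)
  then have "\<nu> = \<nu>'" by simp
  moreover have "(a' - a) * y\<^sup>2 + (b - b') * y + (c - c') = 0" if "0 < y" for y
    using symb[OF that] \<open>\<nu> = \<nu>'\<close> by simp
  from quadratic_zero[OF this] have "a = a'" "b = b'" "c = c'" by auto
  ultimately show ?thesis by (simp add: L)
qed

lemma triplet_unique:
  assumes l: "is_levy_triplet l" "is_levy_triplet l'"
    and eq: "\<And>y. 0 < y \<Longrightarrow> levy_symbol l y = levy_symbol l' y"
  shows "l = l'"
proof -
  obtain \<nu> d c \<nu>' d' c' where L: "l = Levy_Triplet \<nu> d c" "l' = Levy_Triplet \<nu>' d' c'"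
    using l by (cases l; cases l') auto
  note S = l[unfolded L is_levy_triplet.simps]
  have symb: "(\<integral>u. exp (- (u * y)) - 1 \<partial>\<nu>) - (\<integral>u. exp (- (u * y)) - 1 \<partial>\<nu>') = 0 * y\<^sup>2 + (d - d') * y + (c - c')"
    if "0 < y" for y
    using eq[OF that] by (simp add: L algebra_simps)
  have "(if True then \<nu> else \<nu>') = (if False then \<nu> else \<nu>')"
    by (rule jump_measure_unique[where S="{0<..}" and K="\<lambda>y u. exp (- (u * y)) - 1" and \<alpha>=1 and x=0
        and \<beta>="\<lambda>u. 0" and A=0 and B="d - d'" and C="c - c'" and \<nu>="\<lambda>i. if i then \<nu> else \<nu>'"])
      (use S symb in \<open>auto simp: triplet_integrable\<close>)
  then have "\<nu> = \<nu>'" by simp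
  moreover have "0 * y\<^sup>2 + (d - d') * y + (c - c') = 0" if "0 < y" for y
    using symb[OF that] \<open>\<nu> = \<nu>'\<close> by simp
  from quadratic_zero[OF this] have "d = d'" "c = c'" by auto
  ultimately show ?thesis by (simp add: L)
qed

lemma pair_unique:
  assumes l: "is_levy_pair l" "is_levy_pair l'"
    and eq: "\<And>y. 0 < y \<Longrightarrow> levy_symbol l y = levy_symbol l' y"
  shows "l = l'"
proof -
  obtain \<nu> k \<nu>' k' where L: "l = Levy_Pair \<nu> k" "l' = Levy_Pair \<nu>' k'"
    using l by (cases l; cases l') auto
  note S = l[unfolded L is_levy_pair.simps]
  have int: "integrable N (\<lambda>u. exp (- (u * y)))"
    if "0 < y" "sets N = sets (restrict_space borel {0<..})" "\<forall>y>0. (\<integral>\<^sup>+u. ennreal (exp (- (u * y))) \<partial>N) < \<infinity>" for N y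
    using that by (intro integrable_if_dominated[where h="\<lambda>u. exp (- (u * y))" and C=1 and S="{0<..}"]) auto
  have symb: "(\<integral>u. exp (- (u * y)) \<partial>\<nu>) - (\<integral>u. exp (- (u * y)) \<partial>\<nu>') = 0 * y\<^sup>2 + 0 * y + (k' - k)"
    if "0 < y" for y
    using eq[OF that] by (simp add: L algebra_simps)
  have "(if True then \<nu> else \<nu>') = (if False then \<nu> else \<nu>')"
    by (rule jump_measure_unique[where S="{0<..}" and K="\<lambda>y u. exp (- (u * y))" and \<alpha>=0 and x=0
        and \<beta>="\<lambda>u. 0" and A=0 and B=0 and C="k' - k" and \<nu>="\<lambda>i. if i then \<nu> else \<nu>'"])
      (use S symb in \<open>auto simp: int\<close>)
  then have "\<nu> = \<nu>'" by simp
  moreover have "k = k'" using symb[of 1] \<open>\<nu> = \<nu>'\<close> by simp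
  ultimately show ?thesis by (simp add: L)
qed

lemma levy_family_unique:
  assumes l: "levy_family l" "levy_family l'"
    and eq: "\<And>x y. 0 < y \<Longrightarrow> family_symbol l x y = family_symbol l' x y"
  shows "l = l'"
proof
  fix x
  note L = l[unfolded levy_family_def]
  have E: "levy_symbol (l x) y = levy_symbol (l' x) y" if "0 < y" for y
    using eq[OF that, of x] by (simp add: family_symbol_def)
  consider "x = \<infinity>" | "x = 0" | r where "x = ennreal r" "0 < r"
    by (cases x) (auto simp: less_le)
  then show "l x = l' x"
  proof cases
    case 1 then show ?thesis using L E by (intro pair_unique) auto
  next
    case 2 then show ?thesis using L E by (intro triplet_unique) auto
  next
    case 3 then show ?thesis using L E by (intro quadruplet_unique[of r]) auto
  qed
qed

theorem theorem4p2:
  fixes M :: "'w measure"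
    and P :: "ennreal \<Rightarrow> 'w measure"
    and X :: "real \<Rightarrow> 'w \<Rightarrow> ennreal"
  assumes "positive_markov_process M P X"
    and "{exp_fun y | y. 0 < y} \<subseteq> generator_dom P X"
  shows "\<exists>!l. levy_family l \<and>
    (\<forall>x. \<forall>y>0. generator P X (exp_fun y) x =
       (if x = \<infinity> then family_symbol l x y
        else family_symbol l x y * exp (- (enn2real x * y))))"
proof -
  interpret exponential_generator M P X
    using assms by (auto simp: exponential_generator_def exponential_generator_axioms_def)
  have "l = l'"
    if l: "levy_family l" "\<And>x y. 0 < y \<Longrightarrow> G x y =
        (if x = \<infinity> then family_symbol l x y else family_symbol l x y * exp (- (enn2real x * y)))"
      and l': "levy_family l'" "\<And>x y. 0 < y \<Longrightarrow> G x y =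
        (if x = \<infinity> then family_symbol l' x y else family_symbol l' x y * exp (- (enn2real x * y)))"
    for l l'
  proof (rule levy_family_unique[OF l(1) l'(1)])
    fix x :: ennreal and y :: real assume "0 < y"
    then show "family_symbol l x y = family_symbol l' x y"
      using l(2)[of y x] l'(2)[of y x] by (cases "x = \<infinity>") simp_all
  qed
  with levy_family_exists show ?thesis by blast
qed

end
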